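(* Let $(X,J)$ be a lattice one-sided (skip-free downward) Markov additive process as described in the context, with no assumption on the non-singularity of $A_{-1}$. For $a,b\ge0$ let $D_{a,b}$ be the matrix with entries $(D_{a,b})_{ij}=\mathrm P_i[\tau_{-a}<\tau_b^+,\,J_{\tau_{-a}}=j]$ (with $D_{0,0}$ as in the convention given in the context), and for $m\ge1$ let $\Xi(m)$ be the matrix with entries $\Xi(m)_{ij}=\mathrm E_i[L_j(0,\tau_m^+)]$. 1. For $a\ge0$, $b\ge1$, $$D_{a,b}=\Xi(b)\,R^a\,(\Xi(a+b))^{-1}.$$ 2. For $a\ge1$, $D_{a,0}=0$, and $D_{0,0}=I$.
   Context: Setting. $E=\{1,\dots,N\}$ is finite. $(X_t,J_t)_{t\ge0}$ is a continuous-time Markov chain on $\mathbb Z\times E$, possibly killed, with transition rates that are translation-invariant in the level: for every $k$, $A_m$ is the $N\times N$ block of transition rates from level $k$ to level $k+m$, with $A_m=0$ for $m\le-2$. The diagonal of $A_0$ is strictly negative, all other rates are nonnegative. $Q=\sum_{m\ge-1}A_m$, the transition rate matrix of $J$, is irreducible with row sums $\le0$, and $\boldsymbol q=-Q\boldsymbol 1\ge0$ is the vector of killing rates, at which the process is sent to a cemetery state forever. The chain $(X,J)$ on $\mathbb Z\times E$ is assumed irreducible. $\mathrm P_i,\mathrm E_i$ refer to $X_0=0,J_0=i$. $\tau_x=\inf\{t\ge0:X_t=x\}$, $\tau_x^+=\inf\{t\ge0:X_t\ge x\}$, $L_j(x,t)=\int_0^t\mathbf 1\{X_s=x,J_s=j\}\,ds$.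 $R$ is the minimal nonnegative solution of $A_{-1}+RA_0+R^2A_1+R^3A_2+\cdots=0$; equivalently, for $k\ge1$, $(R^k)_{ij}=\mathrm E_i[L_j(-k,\tau'_0)]/\mathrm E_i[L_i(0,\tau_0')]$, where $\tau_0'=\inf\{t\ge\tau^*:X_t=0\}$ and $\tau^*$ is the first jump time of $(X,J)$. Convention: $D_{0,0}=I$. *)

theory Defs
  imports "HOL-Probability.Probability"
begin

section \<open>Continuous-time Markov chains on a discrete state space\<close>

text \<open>
  A process is a map \<open>Z :: real \<Rightarrow> 'w \<Rightarrow> 's\<close>; only times \<open>t \<ge> 0\<close> matter. Its jump times, jump chain
  and holding times are the usual path functionals. After absorption (no further jump) the jump
  time is \<open>\<infinity>\<close>, the jump chain repeats its last value and the holding time is \<open>\<infinity>\<close>.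
\<close>

primrec jump_time :: "(real \<Rightarrow> 'w \<Rightarrow> 's) \<Rightarrow> nat \<Rightarrow> 'w \<Rightarrow> ereal" where
  "jump_time Z 0 \<omega> = 0"
| "jump_time Z (Suc n) \<omega> =
     Inf {ereal t | t. jump_time Z n \<omega> \<le> ereal t \<and> Z t \<omega> \<noteq> Z (real_of_ereal (jump_time Z n \<omega>)) \<omega>}"

primrec jump_chain :: "(real \<Rightarrow> 'w \<Rightarrow> 's) \<Rightarrow> nat \<Rightarrow> 'w \<Rightarrow> 's" where
  "jump_chain Z 0 \<omega> = Z 0 \<omega>"
| "jump_chain Z (Suc n) \<omega> =
     (if jump_time Z (Suc n) \<omega> = \<infinity> then jump_chain Z n \<omega>
      else Z (real_of_ereal (jump_time Z (Suc n) \<omega>)) \<omega>)"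

definition holding_time :: "(real \<Rightarrow> 'w \<Rightarrow> 's) \<Rightarrow> nat \<Rightarrow> 'w \<Rightarrow> ereal" where
  "holding_time Z n \<omega> =
     (if jump_time Z n \<omega> = \<infinity> then \<infinity> else jump_time Z (Suc n) \<omega> - jump_time Z n \<omega>)"

definition jump_prob :: "('s \<Rightarrow> 's \<Rightarrow> real) \<Rightarrow> 's \<Rightarrow> 's \<Rightarrow> real" where
  "jump_prob g x y =
     (if g x x = 0 then (if x = y then 1 else 0)
      else if x = y then 0 else g x y / (- g x x))"

text \<open>
  \<open>Z\<close> is, under \<open>M\<close>, a right-continuous Markov chain with generator matrix \<open>g\<close> (off-diagonal entries
  are the transition rates, \<open>- g x x\<close> is the total exit rate of \<open>x\<close>) started in \<open>z\<close>. The last clause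
  says: the jump chain is a Markov chain with transition matrix \<open>jump_prob g\<close> and, given the jump
  chain, the holding times are independent and exponential with rates \<open>- g (y k) (y k)\<close> (identically
  \<open>\<infinity>\<close> for rate 0). No convention after an explosion is fixed; the
  chains below have bounded exit rates, so they almost surely do not explode.
\<close>

definition markov_chain ::
    "'w measure \<Rightarrow> ('s \<Rightarrow> 's \<Rightarrow> real) \<Rightarrow> 's \<Rightarrow> (real \<Rightarrow> 'w \<Rightarrow> 's) \<Rightarrow> bool" where
  "markov_chain M g z Z \<longleftrightarrow>
     prob_space M \<and>
     (\<forall>t\<ge>0. Z t \<in> M \<rightarrow>\<^sub>M count_space UNIV) \<and>
     (\<forall>\<omega>\<in>space M. \<forall>t\<ge>0. \<forall>\<^sub>F s in at_right t. Z s \<omega> = Z t \<omega>) \<and>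
     (\<forall>n y s. (\<forall>k\<le>n. 0 \<le> s k) \<longrightarrow>
        measure M {\<omega> \<in> space M.
          \<forall>k\<le>n. jump_chain Z k \<omega> = y k \<and> ereal (s k) < holding_time Z k \<omega>} =
        (if y 0 = z then 1 else 0)
        * (\<Prod>k<n. jump_prob g (y k) (y (Suc k)))
        * (\<Prod>k\<le>n. exp (g (y k) (y k) * s k)))"


section \<open>Lattice Markov additive processes, skip-free downward\<close>

definition Q_matrix :: "(int \<Rightarrow> real^'n^'n) \<Rightarrow> real^'n^'n" where
  "Q_matrix A = (\<Sum>m. A (int m - 1))"

definition killing_rate :: "(int \<Rightarrow> real^'n^'n) \<Rightarrow> real^'n" where
  "killing_rate A = - (Q_matrix A *v 1)"

text \<open>
  In the two irreducibility clauses the diagonal may be included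
  among the edges, as it does not change the reflexive transitive closure.
\<close>

definition skip_free_map_rates :: "(int \<Rightarrow> real^'n^'n) \<Rightarrow> bool" where
  "skip_free_map_rates A \<longleftrightarrow>
     (\<forall>m\<le>-2. A m = 0) \<and>
     (\<forall>i. A 0 $ i $ i < 0) \<and>
     (\<forall>m i j. m \<noteq> 0 \<or> i \<noteq> j \<longrightarrow> 0 \<le> A m $ i $ j) \<and>
     summable (\<lambda>m. A (int m - 1)) \<and>
     (\<forall>i. 0 \<le> killing_rate A $ i) \<and>
     {(i, j). 0 < Q_matrix A $ i $ j}\<^sup>* = UNIV \<and>
     {((k, i), (l, j)). 0 < A (l - k) $ i $ j}\<^sup>* = UNIV"

text \<open>Generator of the killed chain; \<open>None\<close> is the cemetery state.\<close>

fun map_generator ::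
    "(int \<Rightarrow> real^'n^'n) \<Rightarrow> (int \<times> 'n) option \<Rightarrow> (int \<times> 'n) option \<Rightarrow> real" where
  "map_generator A (Some (k, i)) (Some (l, j)) = A (l - k) $ i $ j"
| "map_generator A (Some (k, i)) None = killing_rate A $ i"
| "map_generator A None y = 0"

text \<open>The power \<open>^\<close> on \<open>real^'n^'n\<close> is entrywise, hence the following.\<close>

definition matrix_pow :: "real^'n^'n \<Rightarrow> nat \<Rightarrow> real^'n^'n" where
  "matrix_pow M k = (((**) M) ^^ k) (mat 1)"

definition nonneg_solution :: "(int \<Rightarrow> real^'n^'n) \<Rightarrow> real^'n^'n \<Rightarrow> bool" where
  "nonneg_solution A R \<longleftrightarrow>
     0 \<le> R \<and> (\<lambda>m. matrix_pow R m ** A (int m - 1)) sums 0"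

text \<open>\<open>\<le>\<close> on matrices is entrywise.\<close>

definition minimal_nonneg_solution :: "(int \<Rightarrow> real^'n^'n) \<Rightarrow> real^'n^'n \<Rightarrow> bool" where
  "minimal_nonneg_solution A R \<longleftrightarrow>
     nonneg_solution A R \<and> (\<forall>R'. nonneg_solution A R' \<longrightarrow> R \<le> R')"


section \<open>First passage times, local times and the matrices D and Xi\<close>

definition level :: "(real \<Rightarrow> 'w \<Rightarrow> (int \<times> 'n) option) \<Rightarrow> real \<Rightarrow> 'w \<Rightarrow> int option" where
  "level Z t \<omega> = map_option fst (Z t \<omega>)"

definition phase :: "(real \<Rightarrow> 'w \<Rightarrow> (int \<times> 'n) option) \<Rightarrow> real \<Rightarrow> 'w \<Rightarrow> 'n option" where
  "phase Z t \<omega> = map_option snd (Z t \<omega>)"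

definition hit_time :: "(real \<Rightarrow> 'w \<Rightarrow> (int \<times> 'n) option) \<Rightarrow> int \<Rightarrow> 'w \<Rightarrow> ereal" where
  "hit_time Z x \<omega> = Inf {ereal t | t. 0 \<le> t \<and> level Z t \<omega> = Some x}"

definition up_time :: "(real \<Rightarrow> 'w \<Rightarrow> (int \<times> 'n) option) \<Rightarrow> int \<Rightarrow> 'w \<Rightarrow> ereal" where
  "up_time Z x \<omega> = Inf {ereal t | t. 0 \<le> t \<and> (\<exists>k\<ge>x. level Z t \<omega> = Some k)}"

definition local_time ::
    "(real \<Rightarrow> 'w \<Rightarrow> (int \<times> 'n) option) \<Rightarrow> 'n \<Rightarrow> int \<Rightarrow> ereal \<Rightarrow> 'w \<Rightarrow> ennreal" where
  "local_time Z j x T \<omega> =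
     (\<integral>\<^sup>+ s. indicator {s. 0 \<le> s \<and> ereal s \<le> T \<and> Z s \<omega> = Some (x, j)} s \<partial>lborel)"

definition expected_local_time ::
    "('n \<Rightarrow> 'w measure) \<Rightarrow> (real \<Rightarrow> 'w \<Rightarrow> (int \<times> 'n) option) \<Rightarrow> nat \<Rightarrow> 'n \<Rightarrow> 'n \<Rightarrow> ennreal" where
  "expected_local_time P Z m i j =
     (\<integral>\<^sup>+ \<omega>. local_time Z j 0 (up_time Z (int m) \<omega>) \<omega> \<partial>P i)"

definition Xi ::
    "('n \<Rightarrow> 'w measure) \<Rightarrow> (real \<Rightarrow> 'w \<Rightarrow> (int \<times> 'n) option) \<Rightarrow> nat \<Rightarrow> real^'n^'n" where
  "Xi P Z m = (\<chi> i j. enn2real (expected_local_time P Z m i j))"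

text \<open>The case \<open>a = b = 0\<close> is a convention: the defining event would be empty.\<close>

definition D ::
    "('n \<Rightarrow> 'w measure) \<Rightarrow> (real \<Rightarrow> 'w \<Rightarrow> (int \<times> 'n) option) \<Rightarrow> nat \<Rightarrow> nat \<Rightarrow> real^'n^'n" where
  "D P Z a b =
     (if a = 0 \<and> b = 0 then mat 1
      else (\<chi> i j. measure (P i) {\<omega> \<in> space (P i).
              hit_time Z (- int a) \<omega> < up_time Z (int b) \<omega> \<and>
              phase Z (real_of_ereal (hit_time Z (- int a) \<omega>)) \<omega> = Some j}))"

end

theory Submission
  imports Defs
begin

text \<open>
  Let \<open>G\<close> be the matrix of expected local times of level \<open>- a\<close> up to the passage above level \<open>b\<close>, with
  \<open>b \<ge> 1\<close>. It is computed in two ways.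

  At the first visit to level \<open>- a\<close> the strong Markov property and translation invariance give
  \<open>G = D(a,b) \<Xi>(a+b)\<close> (\<open>green_first_passage\<close>). At the last visit to level \<open>0\<close> one gets \<open>G = \<Xi>(b) R\<^sup>a\<close>
  (\<open>green_last_exit\<close>): since the process is skip-free downward, after its last visit to level \<open>0\<close> it
  stays below this level, so that the second factor is the expected local time of level \<open>- a\<close> in an
  excursion below level \<open>0\<close>, per unit of local time at level \<open>0\<close>, irrespective of \<open>b\<close>. Equating the two
  expressions yields the formula once \<open>\<Xi>(a+b)\<close> is known to be finite and invertible.

  Three further points carry the proof. That the excursion quantity is indeed the power \<open>R\<^sup>a\<close> of the
  minimal solution (\<open>minimal_solution_power\<close>) follows from its multiplicativity in \<open>a\<close>, again a last
  exit decomposition; from the last-step equation, which shows that its value at \<open>a = 1\<close>, rescaled by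
  the exit rates, solves the matrix equation; and from an induction on the number of steps, which shows
  that it lies below every nonnegative solution. Finiteness of \<open>\<Xi>\<close> follows from irreducibility
  (\<open>green_finite\<close>): from every state other than the cemetery the levels above \<open>b\<close> are reached with
  positive probability. Invertibility follows from the renewal equation at the first return to level \<open>0\<close>
  (\<open>green_renewal\<close>).

  All decompositions are carried out for the jump chain, as identities between series with values in the
  extended nonnegative reals. The transfer to continuous time rests on the facts that almost surely the
  chain does not explode, as its exit rates are bounded (\<open>AE_nonexplosive\<close>), that the expected holding
  time at a visit to a state of phase \<open>j\<close> is the inverse of its exit rate (\<open>expected_occupation_time\<close>),
  and that events of first passage depend on the jump chain only (\<open>first_hit_prob\<close>).
\<close>

section \<open>Path decompositions for discrete-time chains\<close>

lemma nn_integral_count_space_swap: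
  fixes f :: "'a \<Rightarrow> 'b \<Rightarrow> ennreal"
  shows "(\<integral>\<^sup>+ x. \<integral>\<^sup>+ y. f x y \<partial>count_space UNIV \<partial>count_space UNIV)
    = (\<integral>\<^sup>+ y. \<integral>\<^sup>+ x. f x y \<partial>count_space UNIV \<partial>count_space UNIV)"
  using nn_integral_fst_count_space[of "\<lambda>(x, y). f x y"]
        nn_integral_snd_count_space[of "\<lambda>(x, y). f x y"]
  by simp

lemma nn_integral_count_space_point:
  fixes f :: "'a \<Rightarrow> ennreal"
  shows "(\<integral>\<^sup>+ z. indicator {x} z * f z \<partial>count_space UNIV) = f x"
    and "(\<integral>\<^sup>+ z. f z * indicator {x} z \<partial>count_space UNIV) = f x"
    and "(\<integral>\<^sup>+ z. f z * indicator {z} x \<partial>count_space UNIV) = f x"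
proof -
  show *: "(\<integral>\<^sup>+ z. f z * indicator {x} z \<partial>count_space UNIV) = f x"
    by (subst nn_integral_indicator_singleton) auto
  show "(\<integral>\<^sup>+ z. indicator {x} z * f z \<partial>count_space UNIV) = f x"
    using * by (simp add: mult.commute)
  have "(\<lambda>z. f z * indicator {z} x) = (\<lambda>z. f z * indicator {x} z)"
    by (auto simp: fun_eq_iff indicator_def)
  with * show "(\<integral>\<^sup>+ z. f z * indicator {z} x \<partial>count_space UNIV) = f x" by simp
qed

lemma suminf_convolution_ennreal:
  fixes a b :: "nat \<Rightarrow> ennreal"
  shows "(\<Sum>n. \<Sum>m\<le>n. a m * b (n - m)) = (\<Sum>n. a n) * (\<Sum>n. b n)"
proof -
  let ?f = "\<lambda>m n. if m \<le> n then a m * b (n - m) else 0"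
  have "(\<Sum>n. \<Sum>m\<le>n. a m * b (n - m)) = (\<Sum>n. \<Sum>m. ?f m n)"
    by (intro suminf_cong, subst suminf_finite[of "{..n}" for n])
       (auto intro!: sum.cong)
  also have "\<dots> = (\<Sum>m. \<Sum>n. ?f m n)"
    using nn_integral_count_space_swap[of "\<lambda>n m. ?f m n"] by (simp add: nn_integral_count_space_nat)
  also have "\<dots> = (\<Sum>m. a m * (\<Sum>n. b n))"
  proof (intro suminf_cong)
    fix m
    have "(\<Sum>n. ?f m n) = (\<Sum>n. ?f m (n + m)) + (\<Sum>n<m. ?f m n)"
      by (rule suminf_offset) simp
    also have "(\<Sum>n<m. ?f m n) = 0" by simp
    finally show "(\<Sum>n. ?f m n) = a m * (\<Sum>n. b n)" by (simp add: ennreal_suminf_cmult)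
  qed
  also have "\<dots> = (\<Sum>n. a n) * (\<Sum>n. b n)" by simp
  finally show ?thesis .
qed

lemma suminf_sum_ennreal:
  fixes f :: "'a \<Rightarrow> nat \<Rightarrow> ennreal"
  shows "(\<Sum>n. \<Sum>k\<in>F. f k n) = (\<Sum>k\<in>F. \<Sum>n. f k n)"
  by (rule suminf_sum) simp

text \<open>
  Let \<open>p\<close> be the transition kernel of a chain \<open>Y\<close>. The kernel below gives the probability, starting from
  \<open>x\<close>, that \<open>Y n = y\<close> and that \<open>Y 0, \<dots>, Y (n - 1)\<close> all lie in \<open>B\<close>. The terminal state \<open>y\<close> is not required
  to lie in \<open>B\<close>, so that the same kernel describes both a chain killed outside \<open>B\<close> and the first entrance
  into the complement of \<open>B\<close>. Sums over states are integrals with respect to the counting measure.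
\<close>

primrec taboo_kernel :: "('s \<Rightarrow> 's \<Rightarrow> ennreal) \<Rightarrow> 's set \<Rightarrow> nat \<Rightarrow> 's \<Rightarrow> 's \<Rightarrow> ennreal" where
  "taboo_kernel p B 0 x y = indicator {x} y"
| "taboo_kernel p B (Suc n) x y = indicator B x * (\<integral>\<^sup>+ z. p x z * taboo_kernel p B n z y \<partial>count_space UNIV)"

text \<open>
  The companion kernel constrains the times \<open>1, \<dots>, n\<close> instead: the probability, starting from \<open>x\<close>, that
  \<open>Y n = y\<close> and that \<open>Y 1, \<dots>, Y n\<close> all lie in \<open>B\<close>. The initial state is unconstrained, which is what
  excursions away from \<open>x\<close> require.
\<close>

primrec stay_kernel :: "('s \<Rightarrow> 's \<Rightarrow> ennreal) \<Rightarrow> 's set \<Rightarrow> nat \<Rightarrow> 's \<Rightarrow> 's \<Rightarrow> ennreal" where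
  "stay_kernel p B 0 x y = indicator {x} y"
| "stay_kernel p B (Suc n) x y = (\<integral>\<^sup>+ z. stay_kernel p B n x z * p z y \<partial>count_space UNIV) * indicator B y"

lemma stay_kernel_Suc_first:
  "stay_kernel p B (Suc n) x y = (\<integral>\<^sup>+ z. p x z * indicator B z * stay_kernel p B n z y \<partial>count_space UNIV)"
proof (induction n arbitrary: y)
  case 0
  show ?case
    by (simp only: stay_kernel.simps nn_integral_count_space_point)
next
  case (Suc n)
  have "stay_kernel p B (Suc (Suc n)) x y
      = (\<integral>\<^sup>+ z. (\<integral>\<^sup>+ w. p x w * indicator B w * stay_kernel p B n w z \<partial>count_space UNIV) * p z y
            \<partial>count_space UNIV) * indicator B y"
    unfolding stay_kernel.simps(2)[of p B "Suc n"] Suc ..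
  also have "\<dots> = (\<integral>\<^sup>+ z. \<integral>\<^sup>+ w. p x w * indicator B w * stay_kernel p B n w z * p z y * indicator B y
        \<partial>count_space UNIV \<partial>count_space UNIV)"
    by (simp flip: nn_integral_multc)
  also have "\<dots> = (\<integral>\<^sup>+ w. \<integral>\<^sup>+ z. p x w * indicator B w * stay_kernel p B n w z * p z y * indicator B y
        \<partial>count_space UNIV \<partial>count_space UNIV)"
    by (rule nn_integral_count_space_swap)
  also have "\<dots> = (\<integral>\<^sup>+ w. p x w * indicator B w * stay_kernel p B (Suc n) w y \<partial>count_space UNIV)"
    by (simp add: nn_integral_cmult mult.assoc flip: nn_integral_multc)
  finally show ?case .
qed

lemma stay_kernel_eq_taboo_kernel:
  "indicator B x * stay_kernel p B n x y = taboo_kernel p B n x y * indicator B y"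
proof (induction n arbitrary: x)
  case 0
  show ?case by (auto simp: indicator_def)
next
  case (Suc n)
  have "indicator B x * stay_kernel p B (Suc n) x y
      = indicator B x * (\<integral>\<^sup>+ z. p x z * (indicator B z * stay_kernel p B n z y) \<partial>count_space UNIV)"
    unfolding stay_kernel_Suc_first by (simp add: mult.assoc)
  also have "\<dots> = indicator B x * (\<integral>\<^sup>+ z. p x z * taboo_kernel p B n z y * indicator B y \<partial>count_space UNIV)"
    unfolding Suc by (simp add: mult.assoc)
  also have "\<dots> = taboo_kernel p B (Suc n) x y * indicator B y"
    by (simp add: mult.assoc flip: nn_integral_multc)
  finally show ?case .
qed

text \<open>
  Decomposition of a path that ends in \<open>F\<close> at its first visit to \<open>F\<close>.
\<close>

lemma taboo_first_entrance:
  assumes "finite F" and y: "y \<in> F"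
  shows "taboo_kernel p B n x y
    = (\<Sum>m\<le>n. \<Sum>f\<in>F. taboo_kernel p (B - F) m x f * taboo_kernel p B (n - m) f y)"
proof (induction n arbitrary: x)
  case 0
  have "(\<Sum>f\<in>F. indicator {x} f * indicator {f} y) = (\<Sum>f\<in>{y}. indicator {x} f * indicator {f} y :: ennreal)"
    using assms by (intro sum.mono_neutral_right) (auto simp: indicator_def)
  then show ?case by simp
next
  case (Suc n)
  show ?case
  proof (cases "x \<in> F")
    case True
    have zero: "taboo_kernel p (B - F) (Suc m) x f = 0" for m f using True by simp
    have "(\<Sum>m\<le>Suc n. \<Sum>f\<in>F. taboo_kernel p (B - F) m x f * taboo_kernel p B (Suc n - m) f y)
        = (\<Sum>f\<in>F. indicator {x} f * taboo_kernel p B (Suc n) f y)"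
      unfolding sum.atMost_Suc_shift zero by (simp del: taboo_kernel.simps(2))
    also have "\<dots> = (\<Sum>f\<in>{x}. indicator {x} f * taboo_kernel p B (Suc n) f y)"
      using assms True by (intro sum.mono_neutral_right) (auto simp: indicator_def)
    finally show ?thesis by (simp del: taboo_kernel.simps(2))
  next
    case False
    have ind: "indicator B x = (indicator (B - F) x :: ennreal)" using False by (auto simp: indicator_def)
    have "(\<Sum>f\<in>F. indicator {x} f * taboo_kernel p B (Suc n) f y) = 0"
      using False by (intro sum.neutral) (auto simp: indicator_def)
    then have "(\<Sum>m\<le>Suc n. \<Sum>f\<in>F. taboo_kernel p (B - F) m x f * taboo_kernel p B (Suc n - m) f y)
        = (\<Sum>m\<le>n. \<Sum>f\<in>F. taboo_kernel p (B - F) (Suc m) x f * taboo_kernel p B (n - m) f y)"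
      unfolding sum.atMost_Suc_shift by (simp del: taboo_kernel.simps(2))
    also have "\<dots> = (\<Sum>m\<le>n. \<Sum>f\<in>F. indicator B x *
        (\<integral>\<^sup>+ z. p x z * (taboo_kernel p (B - F) m z f * taboo_kernel p B (n - m) f y) \<partial>count_space UNIV))"
      by (intro sum.cong refl) (simp add: ind mult.assoc flip: nn_integral_multc)
    also have "\<dots> = indicator B x * (\<integral>\<^sup>+ z. (\<Sum>m\<le>n. \<Sum>f\<in>F. p x z * (taboo_kernel p (B
          - F) m z f * taboo_kernel p B (n - m) f y)) \<partial>count_space UNIV)"
      by (simp add: nn_integral_sum sum_distrib_left)
    also have "\<dots> = indicator B x * (\<integral>\<^sup>+ z. p x z * taboo_kernel p B n z y \<partial>count_space UNIV)"
      by (subst Suc) (simp add: sum_distrib_left)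
    finally show ?thesis by simp
  qed
qed

text \<open>
  Decomposition of a path from \<open>x \<notin> C\<close> to \<open>C\<close> at its last visit to \<open>F\<close>. The hypothesis \<open>pred\<close> says that \<open>C\<close>
  can be entered only from \<open>F\<close>; hence after the last visit to \<open>F\<close> the path remains in \<open>C\<close>. The target may
  also be a state of \<open>F\<close>: this makes the induction on the last step go through.
\<close>

lemma stay_last_exit:
  assumes "finite F" and "C \<subseteq> B" and "x \<notin> C" and "F \<inter> C = {}"
    and pred: "\<And>z y. y \<in> C \<Longrightarrow> p z y \<noteq> 0 \<Longrightarrow> z \<in> C \<union> F"
    and y: "y \<in> C \<union> F"
  shows "stay_kernel p B n x y = (\<Sum>m\<le>n. \<Sum>f\<in>F. stay_kernel p B m x f * stay_kernel p C (n - m) f y)"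
  using y
proof (induction n arbitrary: y)
  case 0
  show ?case
  proof (cases "y \<in> F")
    case True
    have "(\<Sum>f\<in>F. indicator {x} f * indicator {f} y) = (\<Sum>f\<in>{y}. indicator {x} f * indicator {f} y :: ennreal)"
      using assms True by (intro sum.mono_neutral_right) (auto simp: indicator_def)
    then show ?thesis by simp
  next
    case False
    then have "(\<Sum>f\<in>F. indicator {x} f * indicator {f} y) = (0::ennreal)"
      by (intro sum.neutral) (auto simp: indicator_def)
    moreover have "x \<noteq> y" using assms(3) 0 False by auto
    ultimately show ?thesis by simp
  qed
next
  case (Suc n)
  have last: "(\<Sum>f\<in>F. stay_kernel p B (Suc n) x f * indicator {f} y)
        = stay_kernel p B (Suc n) x y * indicator F y"
  proof (cases "y \<in> F")
    case True
    have "(\<Sum>f\<in>F. stay_kernel p B (Suc n) x f * indicator {f} y)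
          = (\<Sum>f\<in>{y}. stay_kernel p B (Suc n) x f * indicator {f} y)"
      using assms True by (intro sum.mono_neutral_right) (auto simp: indicator_def)
    then show ?thesis using True by (simp del: stay_kernel.simps(2))
  next
    case False
    then show ?thesis by (auto simp del: stay_kernel.simps(2) intro!: sum.neutral simp: indicator_def)
  qed
  show ?case
  proof (cases "y \<in> F")
    case True
    then have "y \<notin> C" using assms by auto
    then have "(\<Sum>m\<le>n. \<Sum>f\<in>F. stay_kernel p B m x f * stay_kernel p C (Suc n - m) f y) = 0"
      by (intro sum.neutral ballI) (simp add: Suc_diff_le)
    with last True show ?thesis by simp
  next
    case False
    then have yC: "y \<in> C" using Suc.prems by auto
    then have yB: "y \<in> B" using assms by auto
    have "(\<Sum>m\<le>Suc n. \<Sum>f\<in>F. stay_kernel p B m x f * stay_kernel p C (Suc n - m) f y)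
        = (\<Sum>m\<le>n. \<Sum>f\<in>F. stay_kernel p B m x f * stay_kernel p C (Suc (n - m)) f y)"
      using last False by (simp add: Suc_diff_le del: stay_kernel.simps(2))
    also have "\<dots> = (\<integral>\<^sup>+ z. (\<Sum>m\<le>n. \<Sum>f\<in>F. stay_kernel p B m x f * (stay_kernel p C (n
          - m) f z * p z y)) \<partial>count_space UNIV)"
      using yC by (simp add: nn_integral_sum nn_integral_cmult)
    also have "\<dots> = (\<integral>\<^sup>+ z. stay_kernel p B n x z * p z y \<partial>count_space UNIV)"
    proof (intro nn_integral_cong)
      fix z
      show "(\<Sum>m\<le>n. \<Sum>f\<in>F. stay_kernel p B m x f * (stay_kernel p C (n - m) f z * p z y))
            = stay_kernel p B n x z * p z y"
      proof (cases "p z y = 0")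
        case False
        from pred[OF yC False] show ?thesis
          by (subst Suc.IH) (auto simp: sum_distrib_right mult.assoc)
      qed simp
    qed
    finally show ?thesis using yB by simp
  qed
qed

text \<open>
  The probability that \<open>Y 0, \<dots>, Y (n - 1)\<close> all lie in \<open>B\<close>.
\<close>

primrec survival :: "('s \<Rightarrow> 's \<Rightarrow> ennreal) \<Rightarrow> 's set \<Rightarrow> nat \<Rightarrow> 's \<Rightarrow> ennreal" where
  "survival p B 0 x = 1"
| "survival p B (Suc n) x = indicator B x * (\<integral>\<^sup>+ z. p x z * survival p B n z \<partial>count_space UNIV)"

lemma survival_add:
  "survival p B (n + k) x = (\<integral>\<^sup>+ y. taboo_kernel p B n x y * survival p B k y \<partial>count_space UNIV)"
proof (induction n arbitrary: x)
  case 0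
  show ?case by (simp add: nn_integral_count_space_point)
next
  case (Suc n)
  have "survival p B (Suc n + k) x
      = indicator B x * (\<integral>\<^sup>+ z. p x z *
            (\<integral>\<^sup>+ y. taboo_kernel p B n z y * survival p B k y \<partial>count_space UNIV) \<partial>count_space UNIV)"
    by (simp add: Suc)
  also have "\<dots> = indicator B x * (\<integral>\<^sup>+ z. \<integral>\<^sup>+ y. p x z * (taboo_kernel p B n z y * survival p B k y)
        \<partial>count_space UNIV \<partial>count_space UNIV)"
    by (simp add: nn_integral_cmult)
  also have "\<dots> = indicator B x * (\<integral>\<^sup>+ y. \<integral>\<^sup>+ z. p x z * (taboo_kernel p B n z y * survival p B k y)
        \<partial>count_space UNIV \<partial>count_space UNIV)"
    by (subst nn_integral_count_space_swap) simp
  also have "\<dots> = (\<integral>\<^sup>+ y. taboo_kernel p B (Suc n) x y * survival p B k y \<partial>count_space UNIV)"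
    by (simp add: nn_integral_cmult nn_integral_multc flip: mult.assoc)
       (simp add: nn_integral_cmult nn_integral_multc mult.assoc)
  finally show ?case .
qed

lemma survival_le_1:
  assumes "\<And>x. (\<integral>\<^sup>+ z. p x z \<partial>count_space UNIV) \<le> 1"
  shows "survival p B n x \<le> 1"
proof (induction n arbitrary: x)
  case (Suc n)
  have "(\<integral>\<^sup>+ z. p x z * survival p B n z \<partial>count_space UNIV) \<le> (\<integral>\<^sup>+ z. p x z * 1 \<partial>count_space UNIV)"
    using Suc by (intro nn_integral_mono mult_left_mono) auto
  also have "\<dots> \<le> 1" using assms by simp
  finally show ?case by (auto simp: indicator_def)
qed simp

lemma survival_less_1:
  assumes sub: "\<And>x. (\<integral>\<^sup>+ z. p x z \<partial>count_space UNIV) \<le> 1"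
    and path: "(x, w) \<in> {(x, y). p x y \<noteq> 0}\<^sup>*" and "w \<notin> B"
  shows "\<exists>n. survival p B n x < 1"
  using path
proof (induction rule: converse_rtrancl_induct)
  case base
  have "survival p B (Suc 0) w < 1" using \<open>w \<notin> B\<close> by simp
  then show ?case by blast
next
  case (step x z)
  then obtain n where n: "survival p B n z < 1" by blast
  show ?case
  proof (cases "x \<in> B")
    case False
    have "survival p B (Suc 0) x < 1" using \<open>x \<notin> B\<close> by simp
    then show ?thesis by blast
  next
    case True
    define \<epsilon> where "\<epsilon> = 1 - survival p B n z"
    have eps: "\<epsilon> > 0" "survival p B n z + \<epsilon> = 1"
      using n unfolding \<epsilon>_def by (auto simp: diff_gr0_ennreal)
    have "survival p B (Suc n) x + p x z * \<epsilon>
        = (\<integral>\<^sup>+ y. p x y * survival p B n y + p x y * \<epsilon> * indicator {z} y \<partial>count_space UNIV)"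
      using True by (subst nn_integral_add) (auto simp: nn_integral_count_space_point)
    also have "\<dots> \<le> (\<integral>\<^sup>+ y. p x y \<partial>count_space UNIV)"
    proof (intro nn_integral_mono)
      fix y
      have "survival p B n y + \<epsilon> * indicator {z} y \<le> 1"
        using eps survival_le_1[OF sub] by (auto simp: indicator_def)
      from mult_left_mono[OF this, of "p x y"]
      show "p x y * survival p B n y + p x y * \<epsilon> * indicator {z} y \<le> p x y"
        by (simp add: distrib_left mult.assoc)
    qed
    also have "\<dots> \<le> 1" by (rule sub)
    finally have le: "survival p B (Suc n) x + p x z * \<epsilon> \<le> 1" .
    have "p x z * \<epsilon> > 0" using step(1) eps by (auto simp: ennreal_zero_less_mult_iff zero_less_iff_neq_zero)
    moreover have "survival p B (Suc n) x \<noteq> \<top>" using le by (auto simp del: survival.simps simp: top_unique)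
    ultimately have "survival p B (Suc n) x < survival p B (Suc n) x + p x z * \<epsilon>"
      using ennreal_add_left_cancel_less[of "survival p B (Suc n) x" 0 "p x z * \<epsilon>"]
            by (simp del: survival.simps)
    with le have "survival p B (Suc n) x < 1" by order
    then show ?thesis by blast
  qed
qed

text \<open>
  If the complement of \<open>B\<close> can be reached from \<open>y\<close>, then within some \<open>k\<close> steps after a visit to \<open>y\<close> the chain
  leaves \<open>B\<close> with probability at least \<open>\<epsilon> > 0\<close>. As leaving \<open>B\<close> happens only once, each departure is counted
  by at most \<open>k\<close> visits, and the expected number of visits to \<open>y\<close> is at most \<open>k / \<epsilon>\<close>, whatever the
  starting point and although \<open>B\<close> may be infinite.
\<close>

lemma green_finite:
  assumes sub: "\<And>x. (\<integral>\<^sup>+ z. p x z \<partial>count_space UNIV) \<le> 1"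
    and path: "(y, w) \<in> {(x, y). p x y \<noteq> 0}\<^sup>*" and "w \<notin> B"
  shows "(\<Sum>n. taboo_kernel p B n x y) < \<infinity>"
proof -
  obtain k where k: "survival p B k y < 1" using survival_less_1[OF sub path \<open>w \<notin> B\<close>] by blast
  define \<epsilon> where "\<epsilon> = 1 - survival p B k y"
  have eps: "\<epsilon> > 0" "survival p B k y + \<epsilon> = 1"
    using k unfolding \<epsilon>_def by (auto simp: diff_gr0_ennreal)
  \<comment> \<open>Telescoping this inequality over \<open>n\<close> leaves at most \<open>k\<close> survival terms on the right.\<close>
  have step: "survival p B (n + k) x + \<epsilon> * taboo_kernel p B n x y \<le> survival p B n x" for n
  proof -
    have "survival p B (n + k) x + \<epsilon> * taboo_kernel p B n x y
        = (\<integral>\<^sup>+ z. taboo_kernel p B n x z * survival p B k z + taboo_kernel p B n x z * \<epsilon> * indicator {y} z \<partial>count_space UNIV)"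
      unfolding survival_add
      by (subst nn_integral_add) (auto simp: nn_integral_count_space_point mult.commute)
    also have "\<dots> \<le> (\<integral>\<^sup>+ z. taboo_kernel p B n x z * survival p B 0 z \<partial>count_space UNIV)"
    proof (intro nn_integral_mono)
      fix z
      have "survival p B k z + \<epsilon> * indicator {y} z \<le> 1"
        using eps survival_le_1[OF sub] by (auto simp: indicator_def)
      from mult_left_mono[OF this, of "taboo_kernel p B n x z"]
      show "taboo_kernel p B n x z * survival p B k z + taboo_kernel p B n x z * \<epsilon> * indicator {y} z
            \<le> taboo_kernel p B n x z * survival p B 0 z"
        by (simp add: distrib_left mult.assoc)
    qed
    also have "\<dots> = survival p B n x" using survival_add[of p B n 0 x] by simp
    finally show ?thesis .
  qed
  have bound: "\<epsilon> * (\<Sum>n<N. taboo_kernel p B n x y) \<le> of_nat k" for N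
  proof -
    have "(\<Sum>n<N. survival p B (n + k) x) + \<epsilon> * (\<Sum>n<N. taboo_kernel p B n x y)
        \<le> (\<Sum>n<N. survival p B n x)"
      unfolding sum_distrib_left sum.distrib[symmetric] by (intro sum_mono step)
    also have "\<dots> \<le> (\<Sum>n<N+k. survival p B n x)"
      by (intro sum_mono2) auto
    also have "\<dots> = (\<Sum>n<k. survival p B n x) + (\<Sum>n<N. survival p B (n + k) x)"
      by (induction N) (simp_all add: add.assoc)
    also have "\<dots> \<le> of_nat k + (\<Sum>n<N. survival p B (n + k) x)"
    proof (intro add_right_mono)
      have "(\<Sum>n<k. survival p B n x) \<le> (\<Sum>n<k. 1)" by (intro sum_mono survival_le_1 sub)
      then show "(\<Sum>n<k. survival p B n x) \<le> of_nat k" by simp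
    qed
    finally have "(\<Sum>n<N. survival p B (n + k) x) + \<epsilon> * (\<Sum>n<N. taboo_kernel p B n x y)
      \<le> (\<Sum>n<N. survival p B (n + k) x) + of_nat k" by (simp add: add.commute)
    moreover have "(\<Sum>n<N. survival p B (n + k) x) \<noteq> \<top>"
    proof -
      have "survival p B m x < \<top>" for m
        using survival_le_1[OF sub] by (rule le_less_trans) simp
      then show ?thesis by (simp add: less_top)
    qed
    ultimately show ?thesis by (simp only: ennreal_add_left_cancel_le infinity_ennreal_def) blast
  qed
  have "\<epsilon> * (\<Sum>n. taboo_kernel p B n x y) \<le> of_nat k"
  proof -
    have "\<epsilon> * (\<Sum>n. taboo_kernel p B n x y) = (\<Sum>n. \<epsilon> * taboo_kernel p B n x y)" by simp
    also have "\<dots> \<le> of_nat k"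
      using bound by (intro suminf_le_const) (auto simp: sum_distrib_left)
    finally show ?thesis .
  qed
  then have "\<epsilon> * (\<Sum>n. taboo_kernel p B n x y) < \<top>" by (rule le_less_trans) (rule of_nat_less_top)
  moreover have "\<epsilon> * \<top> = \<top>" using eps(1) by (simp add: ennreal_mult_top)
  ultimately have "(\<Sum>n. taboo_kernel p B n x y) \<noteq> \<top>" by (intro notI) simp
  then show ?thesis by (simp only: infinity_ennreal_def less_top)
qed

lemma taboo_bij:
  assumes "bij \<phi>" and "\<And>x y. p (\<phi> x) (\<phi> y) = p x y"
  shows "taboo_kernel p (\<phi> ` B) n (\<phi> x) (\<phi> y) = taboo_kernel p B n x y"
proof (induction n arbitrary: x)
  case 0
  show ?case using assms(1) by (auto simp: indicator_def bij_def inj_eq)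
next
  case (Suc n)
  have "(\<integral>\<^sup>+ z. p (\<phi> x) z * taboo_kernel p (\<phi> ` B) n z (\<phi> y) \<partial>count_space UNIV)
      = (\<integral>\<^sup>+ z. p (\<phi> x) (\<phi> z) * taboo_kernel p (\<phi> ` B) n (\<phi> z) (\<phi> y) \<partial>count_space UNIV)"
    by (rule nn_integral_bij_count_space[symmetric]) (use assms in simp)
  moreover have "indicator (\<phi> ` B) (\<phi> x) = (indicator B x :: ennreal)"
    using assms(1) by (auto simp: indicator_def bij_def inj_image_mem_iff)
  ultimately show ?case by (simp add: Suc assms(2))
qed

lemma stay_bij:
  assumes "bij \<phi>" and "\<And>x y. p (\<phi> x) (\<phi> y) = p x y"
  shows "stay_kernel p (\<phi> ` B) n (\<phi> x) (\<phi> y) = stay_kernel p B n x y"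
proof (induction n arbitrary: y)
  case 0
  show ?case using assms(1) by (auto simp: indicator_def bij_def inj_eq)
next
  case (Suc n)
  have "(\<integral>\<^sup>+ z. stay_kernel p (\<phi> ` B) n (\<phi> x) z * p z (\<phi> y) \<partial>count_space UNIV)
      = (\<integral>\<^sup>+ z. stay_kernel p (\<phi> ` B) n (\<phi> x) (\<phi> z) * p (\<phi> z) (\<phi> y) \<partial>count_space UNIV)"
    by (rule nn_integral_bij_count_space[symmetric]) (use assms in simp)
  moreover have "indicator (\<phi> ` B) (\<phi> y) = (indicator B y :: ennreal)"
    using assms(1) by (auto simp: indicator_def bij_def inj_image_mem_iff)
  ultimately show ?case by (simp add: Suc assms(2))
qed

section \<open>Right-continuous paths with values in a countable set\<close>

text \<open>
  A process with values in a countable set whose paths are right-continuous for the discrete topology.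
\<close>

locale right_cont_process =
  fixes M :: "'w measure" and Z :: "real \<Rightarrow> 'w \<Rightarrow> 's::countable"
  assumes Z_measurable: "0 \<le> t \<Longrightarrow> Z t \<in> M \<rightarrow>\<^sub>M count_space UNIV"
    and right_cont: "\<omega> \<in> space M \<Longrightarrow> 0 \<le> t \<Longrightarrow> \<forall>\<^sub>F s in at_right t. Z s \<omega> = Z t \<omega>"
begin

abbreviation "JT n \<omega> \<equiv> jump_time Z n \<omega>"
abbreviation "JC n \<omega> \<equiv> jump_chain Z n \<omega>"
abbreviation "HT n \<omega> \<equiv> holding_time Z n \<omega>"

lemma right_contE:
  assumes "\<omega> \<in> space M" "0 \<le> t"
  obtains u where "t < u" "\<And>s. t \<le> s \<Longrightarrow> s < u \<Longrightarrow> Z s \<omega> = Z t \<omega>"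
proof -
  obtain u where "u > t" "\<forall>s>t. s < u \<longrightarrow> Z s \<omega> = Z t \<omega>"
    using right_cont[OF assms] unfolding eventually_at_right_field by blast
  then show ?thesis by (intro that[of u]) (auto simp: le_less)
qed

lemma Z_max_measurable [measurable]: "Z (max 0 r) \<in> M \<rightarrow>\<^sub>M count_space UNIV"
  by (rule Z_measurable) simp

text \<open>
  By right-continuity only rational times matter, so the first time at or after \<open>T\<close> at which the process is
  in a random set \<open>C\<close> is measurable. With a deterministic set this covers hitting times, with
  \<open>C = {y. y \<noteq> Z T}\<close> it covers the successive jump times.
\<close>

lemma entry_time_measurable:
  assumes T [measurable]: "T \<in> borel_measurable M" and T0: "\<And>\<omega>. 0 \<le> T \<omega>"
    and C [measurable]: "\<And>y. Measurable.pred M (\<lambda>\<omega>. y \<in> C \<omega>)"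
  shows "(\<lambda>\<omega>. Inf {ereal t | t. T \<omega> \<le> ereal t \<and> Z t \<omega> \<in> C \<omega>}) \<in> borel_measurable M"
proof (rule borel_measurableI_less)
  fix a :: ereal
  have "Measurable.pred M (\<lambda>\<omega>. \<exists>(q::rat) y. T \<omega> \<le> ereal (of_rat q) \<and> ereal (of_rat q) < a
          \<and> Z (max 0 (of_rat q)) \<omega> = y \<and> y \<in> C \<omega>)" (is "Measurable.pred M ?P")
    by measurable
  moreover have "(Inf {ereal t | t. T \<omega> \<le> ereal t \<and> Z t \<omega> \<in> C \<omega>} < a) = ?P \<omega>" if \<omega>: "\<omega> \<in> space M" for \<omega>
  proof
    assume "Inf {ereal t | t. T \<omega> \<le> ereal t \<and> Z t \<omega> \<in> C \<omega>} < a"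
    then obtain t where t: "T \<omega> \<le> ereal t" "Z t \<omega> \<in> C \<omega>" "ereal t < a"
      by (auto simp: Inf_less_iff)
    have t0: "0 \<le> t" using order_trans[OF T0[of \<omega>] t(1)] by simp
    obtain u where u: "t < u" "\<And>s. t \<le> s \<Longrightarrow> s < u \<Longrightarrow> Z s \<omega> = Z t \<omega>"
      using right_contE[OF \<omega> t0] by blast
    obtain v where v: "t < v" "v \<le> u" "ereal v \<le> a"
    proof (cases a)
      case (real r)
      then show ?thesis using t(3) u(1) that[of "min r u"] by auto
    next
      case PInf
      then show ?thesis using u(1) that[of u] by auto
    next
      case MInf
      then show ?thesis using t(3) by auto
    qed
    obtain q where q: "t < of_rat q" "of_rat q < v" using of_rat_dense[OF v(1)] by blast
    have "ereal (of_rat q) < a" using q v by (meson ereal_less_eq(3) less_ereal.simps(1) less_le_trans)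
    moreover have "T \<omega> \<le> ereal (of_rat q)" using t(1) q(1) by (meson ereal_less_eq(3) less_imp_le order_trans)
    moreover have "max 0 (of_rat q) = (of_rat q :: real)" using q(1) t0 by (intro max_absorb2) linarith
    then have "Z (max 0 (of_rat q)) \<omega> = Z t \<omega>" using q v u(2)[of "of_rat q"] by simp
    ultimately show "?P \<omega>" using t(2) by auto
  next
    assume "?P \<omega>"
    then obtain q :: rat where q: "T \<omega>
          \<le> ereal (of_rat q)" "ereal (of_rat q) < a" "Z (max 0 (of_rat q)) \<omega> \<in> C \<omega>"
      by blast
    have "0 \<le> (of_rat q :: real)" using order_trans[OF T0[of \<omega>] q(1)] by simp
    with q show "Inf {ereal t | t. T \<omega> \<le> ereal t \<and> Z t \<omega> \<in> C \<omega>} < a"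
      unfolding Inf_less_iff by (auto simp: max_def intro!: exI[of _ "of_rat q"])
  qed
  ultimately show "{\<omega> \<in> space M. Inf {ereal t | t. T \<omega> \<le> ereal t \<and> Z t \<omega> \<in> C \<omega>} < a} \<in> sets M"
    unfolding pred_def by (simp cong: conj_cong)
qed

text \<open>
  At \<open>T = \<infinity>\<close> the time \<open>real_of_ereal T\<close> is \<open>0\<close>, which is harmless here.
\<close>

lemma Z_at_time_measurable:
  assumes T [measurable]: "T \<in> borel_measurable M" and T0: "\<And>\<omega>. 0 \<le> T \<omega>"
  shows "(\<lambda>\<omega>. Z (real_of_ereal (T \<omega>)) \<omega>) \<in> M \<rightarrow>\<^sub>M count_space UNIV"
proof (subst measurable_count_space_eq_countable, simp, safe)
  fix y
  have "Measurable.pred M (\<lambda>\<omega>. \<exists>q::rat. real_of_ereal (T \<omega>) < of_rat q \<and>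
      (\<forall>r::rat. real_of_ereal (T \<omega>) < of_rat r \<longrightarrow> (of_rat r :: real) < of_rat q \<longrightarrow> Z (max 0 (of_rat r)) \<omega> = y))"
    (is "Measurable.pred M ?P")
    by measurable
  moreover have "(Z (real_of_ereal (T \<omega>)) \<omega> = y) = ?P \<omega>" if \<omega>: "\<omega> \<in> space M" for \<omega>
  proof -
    let ?t = "real_of_ereal (T \<omega>)"
    have t0: "0 \<le> ?t" using T0[of \<omega>] by (simp add: real_of_ereal_pos)
    obtain u where u: "?t < u" "\<And>s. ?t \<le> s \<Longrightarrow> s < u \<Longrightarrow> Z s \<omega> = Z ?t \<omega>"
      using right_contE[OF \<omega> t0] by blast
    show ?thesis
    proof
      assume y: "Z ?t \<omega> = y"
      obtain q where q: "?t < of_rat q" "of_rat q < u" using of_rat_dense[OF u(1)] by blast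
      have "Z (max 0 (of_rat r)) \<omega> = y" if "?t < of_rat r" "(of_rat r::real) < of_rat q" for r
      proof -
        have "max 0 (of_rat r) = (of_rat r :: real)" using that(1) t0 by (intro max_absorb2) linarith
        then show ?thesis using that q(2) u(2)[of "of_rat r"] y by simp
      qed
      with q(1) show "?P \<omega>" by blast
    next
      assume "?P \<omega>"
      then obtain q :: rat where q: "?t < of_rat q"
        "\<And>r. ?t < of_rat r \<Longrightarrow> (of_rat r :: real) < of_rat q \<Longrightarrow> Z (max 0 (of_rat r)) \<omega> = y" by blast
      have "?t < min u (of_rat q)" using u(1) q(1) by simp
      then obtain r where r: "?t < of_rat r" "of_rat r < min u (of_rat q)" using of_rat_dense by blast
      have "Z (max 0 (of_rat r)) \<omega> = y" using q(2)[of r] r by simp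
      moreover have "max 0 (of_rat r) = (of_rat r :: real)" using r(1) t0 by (intro max_absorb2) linarith
      then have "Z (max 0 (of_rat r)) \<omega> = Z ?t \<omega>" using u(2)[of "of_rat r"] r by simp
      ultimately show "Z ?t \<omega> = y" by simp
    qed
  qed
  then have "(\<lambda>\<omega>. Z (real_of_ereal (T \<omega>)) \<omega>) -` {y} \<inter> space M = {\<omega> \<in> space M. ?P \<omega>}" by auto
  ultimately show "(\<lambda>\<omega>. Z (real_of_ereal (T \<omega>)) \<omega>) -` {y} \<inter> space M \<in> sets M"
    unfolding pred_def by simp
qed simp_all

lemma jump_time_mono1: "JT n \<omega> \<le> JT (Suc n) \<omega>"
  by (auto intro: Inf_greatest)

lemma jump_time_mono: "m \<le> n \<Longrightarrow> JT m \<omega> \<le> JT n \<omega>"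
  by (rule lift_Suc_mono_le[of "\<lambda>n. JT n \<omega>"]) (rule jump_time_mono1)

lemma jump_time_nonneg: "0 \<le> JT n \<omega>"
  using jump_time_mono[of 0 n \<omega>] by simp

lemma jump_time_measurable [measurable]: "jump_time Z n \<in> borel_measurable M"
proof (induction n)
  case 0
  have "jump_time Z 0 = (\<lambda>_. 0)" by (rule ext) simp
  then show ?case by simp
next
  case (Suc n)
  note [measurable] = Suc
  have [measurable]: "(\<lambda>\<omega>. Z (real_of_ereal (JT n \<omega>)) \<omega>) \<in> M \<rightarrow>\<^sub>M count_space UNIV"
    by (rule Z_at_time_measurable[OF Suc jump_time_nonneg])
  have "(\<lambda>\<omega>. Inf {ereal t | t. JT n \<omega>
        \<le> ereal t \<and> Z t \<omega> \<in> {y. y \<noteq> Z (real_of_ereal (JT n \<omega>)) \<omega>}}) \<in> borel_measurable M"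
    by (rule entry_time_measurable[OF Suc jump_time_nonneg]) measurable
  also have "(\<lambda>\<omega>. Inf {ereal t | t. JT n \<omega> \<le> ereal t \<and> Z t \<omega> \<in> {y. y \<noteq> Z (real_of_ereal (JT n \<omega>)) \<omega>}})
      = jump_time Z (Suc n)" by (rule ext) simp
  finally show ?case .
qed

lemma Z_at_jump_measurable [measurable]:
  "(\<lambda>\<omega>. Z (real_of_ereal (JT n \<omega>)) \<omega>) \<in> M \<rightarrow>\<^sub>M count_space UNIV"
  by (rule Z_at_time_measurable[OF jump_time_measurable jump_time_nonneg])

lemma jump_time_infinite_measurable [measurable]: "Measurable.pred M (\<lambda>\<omega>. JT n \<omega> = \<infinity>)"
proof -
  have inf: "{\<infinity>::ereal} \<in> sets borel" by (rule borel_closed[OF closed_singleton])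
  have eq: "{\<omega> \<in> space M. JT n \<omega> = \<infinity>} = jump_time Z n -` {\<infinity>} \<inter> space M" by auto
  show ?thesis
    unfolding pred_def eq by (rule measurable_sets[OF jump_time_measurable inf])
qed

lemma jump_chain_measurable [measurable]: "jump_chain Z n \<in> M \<rightarrow>\<^sub>M count_space UNIV"
proof (induction n)
  case 0
  have "jump_chain Z 0 = Z 0" by (rule ext) simp
  then show ?case using Z_measurable[of 0] by simp
next
  case (Suc n)
  note [measurable] = Suc
  have "(\<lambda>\<omega>. if JT (Suc n) \<omega>
        = \<infinity> then JC n \<omega> else Z (real_of_ereal (JT (Suc n) \<omega>)) \<omega>) \<in> M \<rightarrow>\<^sub>M count_space UNIV"
    by (rule measurable_If[OF Suc Z_at_jump_measurable jump_time_infinite_measurable[unfolded pred_def]])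
  also have "(\<lambda>\<omega>. if JT (Suc n) \<omega> = \<infinity> then JC n \<omega> else Z (real_of_ereal (JT (Suc n) \<omega>)) \<omega>)
      = jump_chain Z (Suc n)" by (rule ext) simp
  finally show ?case .
qed

lemma holding_time_measurable [measurable]: "holding_time Z n \<in> borel_measurable M"
proof -
  have "(\<lambda>\<omega>. if JT n \<omega> = \<infinity> then \<infinity> else JT (Suc n) \<omega> - JT n \<omega>) \<in> borel_measurable M"
    by (rule measurable_If)
          (use jump_time_infinite_measurable[of n] in \<open>simp_all add: pred_def del: jump_time.simps\<close>)
  also have "(\<lambda>\<omega>. if JT n \<omega> = \<infinity> then \<infinity> else JT (Suc n) \<omega> - JT n \<omega>) = holding_time Z n"
    by (rule ext) (simp add: holding_time_def)
  finally show ?thesis .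
qed

lemma jump_chain_eq: "JT n \<omega> \<noteq> \<infinity> \<Longrightarrow> JC n \<omega> = Z (real_of_ereal (JT n \<omega>)) \<omega>"
  by (cases n) (auto simp del: jump_time.simps(2))

lemma jump_time_real:
  assumes "JT n \<omega> \<noteq> \<infinity>"
  obtains t where "JT n \<omega> = ereal t" "0 \<le> t"
  using assms jump_time_nonneg[of n \<omega>] by (cases "JT n \<omega>") auto

lemma jump_time_strict:
  assumes \<omega>: "\<omega> \<in> space M" and fin: "JT n \<omega> \<noteq> \<infinity>"
  shows "JT n \<omega> < JT (Suc n) \<omega>"
proof -
  obtain t where t: "JT n \<omega> = ereal t" "0 \<le> t" using jump_time_real[OF fin] .
  obtain u where u: "t < u" "\<And>s. t \<le> s \<Longrightarrow> s < u \<Longrightarrow> Z s \<omega> = Z t \<omega>"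
    using right_contE[OF \<omega> t(2)] by blast
  have "ereal u \<le> JT (Suc n) \<omega>"
    using u(2) by (force simp: t(1) intro!: Inf_greatest)
  then show ?thesis using t(1) u(1) by (metis less_ereal.simps(1) less_le_trans)
qed

lemma holding_time_pos: "\<omega> \<in> space M \<Longrightarrow> 0 < HT n \<omega>"
  using jump_time_strict[of \<omega> n] unfolding holding_time_def
  by (auto simp: ereal_minus_less_iff ereal_less_minus_iff simp del: jump_time.simps)

lemma Z_between_jumps:
  assumes "JT n \<omega> \<le> ereal s" "ereal s < JT (Suc n) \<omega>"
  shows "Z s \<omega> = JC n \<omega>"
proof -
  have "JT n \<omega> \<noteq> \<infinity>" using assms(1) by auto
  moreover have "Z s \<omega> = Z (real_of_ereal (JT n \<omega>)) \<omega>"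
  proof (rule ccontr)
    assume "Z s \<omega> \<noteq> Z (real_of_ereal (JT n \<omega>)) \<omega>"
    then have "JT (Suc n) \<omega> \<le> ereal s" using assms(1) by (auto intro!: Inf_lower)
    with assms(2) show False by simp
  qed
  ultimately show ?thesis by (simp add: jump_chain_eq)
qed

lemma jump_interval_exists:
  assumes "0 \<le> s" "ereal s < JT N \<omega>"
  obtains i where "i < N" "JT i \<omega> \<le> ereal s" "ereal s < JT (Suc i) \<omega>"
  using assms(2)
proof (induction N arbitrary: thesis)
  case 0
  then show ?case using assms(1) by simp
next
  case (Suc N)
  show ?case
  proof (cases "ereal s < JT N \<omega>")
    case True
    then show ?thesis using Suc.IH Suc.prems(1) less_Suc_eq by metis
  next
    case False
    then show ?thesis using Suc.prems by (meson lessI not_less)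
  qed
qed

text \<open>
  The jump times of the path tend to infinity.
\<close>

definition nonexplosive :: "'w \<Rightarrow> bool" where
  "nonexplosive \<omega> \<longleftrightarrow> (\<forall>s. \<exists>n. ereal s < JT n \<omega>)"

lemma nonexplosiveI:
  assumes inf: "\<And>m. \<exists>n\<ge>m. 1 < HT n \<omega>"
  shows "nonexplosive \<omega>"
proof -
  have "\<exists>n. ereal (real N) \<le> JT n \<omega>" for N
  proof (induction N)
    case 0
    then show ?case by (auto intro: exI[of _ 0] simp: zero_ereal_def)
  next
    case (Suc N)
    then obtain n where n: "ereal (real N) \<le> JT n \<omega>" by blast
    obtain k where k: "n \<le> k" "1 < HT k \<omega>" using inf by blast
    show ?case
    proof (cases "JT k \<omega> = \<infinity>")
      case True
      then show ?thesis by (auto intro!: exI[of _ k])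
    next
      case False
      obtain t where t: "JT k \<omega> = ereal t" "0 \<le> t" using jump_time_real[OF False] .
      have "ereal (real N) \<le> ereal t" using n jump_time_mono[OF k(1), of \<omega>] t(1) by (metis order_trans)
      moreover have "1 < JT (Suc k) \<omega> - ereal t"
        using k(2) t(1) unfolding holding_time_def by (simp del: jump_time.simps)
      ultimately have "ereal (real (Suc N)) \<le> JT (Suc k) \<omega>"
        by (cases "JT (Suc k) \<omega>") (auto simp del: jump_time.simps simp: one_ereal_def)
      then show ?thesis by blast
    qed
  qed
  then show ?thesis unfolding nonexplosive_def
    by (metis ereal_less_eq(3) less_ereal.simps(1) less_le_trans reals_Archimedean2)
qed

text \<open>
  The first time at which the process is in \<open>C\<close>; both the hitting time of a level and the passage time above
  a level are of this form.
\<close>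

definition entry_time :: "'s set \<Rightarrow> 'w \<Rightarrow> ereal" where
  "entry_time C \<omega> = Inf {ereal t | t. 0 \<le> t \<and> Z t \<omega> \<in> C}"

lemma entry_time_measurable' [measurable]: "entry_time C \<in> borel_measurable M"
  using entry_time_measurable[of "\<lambda>_. 0" "\<lambda>_. C"]
  by (simp add: entry_time_def[abs_def] zero_ereal_def)

lemma entry_time_le:
  assumes "JC n \<omega> \<in> C" and fin: "JT n \<omega> \<noteq> \<infinity>"
  shows "entry_time C \<omega> \<le> JT n \<omega>"
proof -
  obtain t where t: "JT n \<omega> = ereal t" "0 \<le> t" using jump_time_real[OF fin] .
  then have "Z t \<omega> \<in> C" using assms(1) jump_chain_eq[OF fin] by simp
  then show ?thesis unfolding entry_time_def t(1) using t(2) by (intro Inf_lower) auto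
qed

lemma entry_time_ge:
  assumes "\<And>i. i < N \<Longrightarrow> JC i \<omega> \<notin> C"
  shows "JT N \<omega> \<le> entry_time C \<omega>"
  unfolding entry_time_def
proof (intro Inf_greatest, clarify)
  fix t :: real assume t: "0 \<le> t" "Z t \<omega> \<in> C"
  show "JT N \<omega> \<le> ereal t"
  proof (rule ccontr)
    assume "\<not> JT N \<omega> \<le> ereal t"
    then obtain i where "i < N" "JT i \<omega> \<le> ereal t" "ereal t < JT (Suc i) \<omega>"
      using jump_interval_exists[OF t(1)] by (metis not_less)
    then show False using Z_between_jumps[of i \<omega> t] t(2) assms by metis
  qed
qed

lemma entry_timeE:
  assumes "nonexplosive \<omega>" "entry_time C \<omega> \<noteq> \<infinity>"
  obtains N where "entry_time C \<omega> = JT N \<omega>" "JC N \<omega> \<in> C" "\<And>i. i < N \<Longrightarrow> JC i \<omega> \<notin> C"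
proof -
  have "entry_time C \<omega> < \<infinity>" using assms(2) by simp
  then obtain t where t: "0 \<le> t" "Z t \<omega> \<in> C" unfolding entry_time_def Inf_less_iff by blast
  obtain n where "ereal t < JT n \<omega>" using assms(1) unfolding nonexplosive_def by blast
  then obtain i where i: "JT i \<omega> \<le> ereal t" "ereal t < JT (Suc i) \<omega>"
    using jump_interval_exists[OF t(1)] by metis
  have ex: "JC i \<omega> \<in> C" using Z_between_jumps[OF i] t(2) by simp
  define N where "N = (LEAST i. JC i \<omega> \<in> C)"
  have N: "JC N \<omega> \<in> C" "\<And>i. i < N \<Longrightarrow> JC i \<omega> \<notin> C" "N \<le> i"
    unfolding N_def using ex by (auto intro: LeastI Least_le dest: not_less_Least)
  have "JT N \<omega> \<noteq> \<infinity>" using jump_time_mono[OF N(3), of \<omega>] i(1) by auto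
  then have "entry_time C \<omega> = JT N \<omega>"
    using entry_time_le[OF N(1)] entry_time_ge[OF N(2)] by (intro antisym) auto
  with N that show ?thesis by blast
qed

lemma entry_time_attained:
  assumes \<omega>: "\<omega> \<in> space M" and fin: "entry_time C \<omega> \<noteq> \<infinity>"
  shows "Z (real_of_ereal (entry_time C \<omega>)) \<omega> \<in> C"
proof -
  have ge: "0 \<le> entry_time C \<omega>" unfolding entry_time_def by (rule Inf_greatest) auto
  then obtain t where t: "entry_time C \<omega> = ereal t" "0 \<le> t" using fin by (cases "entry_time C \<omega>") auto
  obtain u where u: "t < u" "\<And>s. t \<le> s \<Longrightarrow> s < u \<Longrightarrow> Z s \<omega> = Z t \<omega>"
    using right_contE[OF \<omega> t(2)] by blast
  have "entry_time C \<omega> < ereal u" using t(1) u(1) by simp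
  then obtain s where s: "0 \<le> s" "Z s \<omega> \<in> C" "s < u" unfolding entry_time_def Inf_less_iff by auto
  have "entry_time C \<omega> \<le> ereal s" unfolding entry_time_def using s by (intro Inf_lower) auto
  then have "t \<le> s" using t(1) by simp
  then show ?thesis using u(2)[of s] s t(1) by simp
qed

text \<open>
  The event that \<open>C\<close> is hit before \<open>U\<close>, at the state \<open>y\<close>, expressed by the jump chain alone.
\<close>

lemma first_hit_iff:
  assumes \<omega>: "\<omega> \<in> space M" and ne: "nonexplosive \<omega>" and disj: "C \<inter> U = {}" and "y \<in> C"
  shows "entry_time C \<omega> < entry_time U \<omega> \<and> Z (real_of_ereal (entry_time C \<omega>)) \<omega> = y
    \<longleftrightarrow> (\<exists>n. (\<forall>i<n. JC i \<omega> \<in> - U - C) \<and> JC n \<omega> = y)" (is "?L \<longleftrightarrow> ?R")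
proof
  assume L: ?L
  then have fin: "entry_time C \<omega> \<noteq> \<infinity>" by auto
  from entry_timeE[OF ne this] obtain N where N: "entry_time C \<omega> = JT N \<omega>" "JC N \<omega> \<in> C"
    "\<And>i. i < N \<Longrightarrow> JC i \<omega> \<notin> C" by blast
  have "JC i \<omega> \<notin> U" if "i < N" for i
  proof
    assume "JC i \<omega> \<in> U"
    moreover have le: "JT i \<omega> \<le> JT N \<omega>" using that by (intro jump_time_mono) simp
    moreover have "JT i \<omega> \<noteq> \<infinity>" using le fin N(1) by auto
    ultimately have "entry_time U \<omega> \<le> JT N \<omega>" using entry_time_le order_trans by blast
    moreover have "JT N \<omega> < entry_time U \<omega>" using L N(1) by simp
    ultimately show False by order
  qed
  moreover have "JC N \<omega> = y" using L fin N(1) jump_chain_eq by metis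
  ultimately show ?R using N(3) by blast
next
  assume ?R
  then obtain n where n: "\<And>i. i < n \<Longrightarrow> JC i \<omega> \<in> - U - C" "JC n \<omega> = y" by blast
  \<comment> \<open>An absorbed jump chain repeats its last value, but the state \<open>y\<close> differs from all earlier ones.\<close>
  have fin: "JT n \<omega> \<noteq> \<infinity>"
  proof (cases n)
    case (Suc m)
    then show ?thesis using n(1)[of m] n(2) \<open>y \<in> C\<close> by (auto simp del: jump_time.simps)
  qed simp
  have "entry_time C \<omega> = JT n \<omega>"
    using n \<open>y \<in> C\<close> fin by (intro antisym entry_time_le entry_time_ge) auto
  moreover have "JT (Suc n) \<omega> \<le> entry_time U \<omega>"
    using n \<open>y \<in> C\<close> disj by (intro entry_time_ge) (auto simp: less_Suc_eq)
  ultimately show ?L using jump_time_strict[OF \<omega> fin] n(2) jump_chain_eq[OF fin] by auto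
qed

lemma sojourn_integral:
  assumes "\<omega> \<in> space M" and fin: "JT n \<omega> \<noteq> \<infinity>"
  shows "(\<integral>\<^sup>+ s. indicator {s. JT n \<omega> \<le> ereal s \<and> ereal s < JT (Suc n) \<omega>} s \<partial>lborel)
    = (\<integral>\<^sup>+ s. indicator {s. 0 \<le> s \<and> ereal s < HT n \<omega>} s \<partial>lborel)"
proof -
  obtain t where t: "JT n \<omega> = ereal t" "0 \<le> t" using jump_time_real[OF fin] .
  have "(\<integral>\<^sup>+ s. indicator {s. JT n \<omega> \<le> ereal s \<and> ereal s < JT (Suc n) \<omega>} s \<partial>lborel)
    = ennreal \<bar>1\<bar> * (\<integral>\<^sup>+ s. indicator {s. JT n \<omega> \<le> ereal s \<and> ereal s < JT (Suc n) \<omega>} (t + 1 * s) \<partial>lborel)"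
    by (rule nn_integral_real_affine) (simp_all del: jump_time.simps)
  also have "\<dots> = (\<integral>\<^sup>+ s. indicator {s. JT n \<omega> \<le> ereal s \<and> ereal s < JT (Suc n) \<omega>} (t + 1 * s) \<partial>lborel)"
    by simp
  also have "\<dots> = (\<integral>\<^sup>+ s. indicator {s. 0 \<le> s \<and> ereal s < HT n \<omega>} s \<partial>lborel)"
  proof (intro nn_integral_cong)
    fix s
    show "indicator {s. JT n \<omega> \<le> ereal s \<and> ereal s < JT (Suc n) \<omega>} (t + 1 * s)
      = (indicator {s. 0 \<le> s \<and> ereal s < HT n \<omega>} s :: ennreal)"
      unfolding holding_time_def using t
      by (cases "JT (Suc n) \<omega>") (auto simp: indicator_def simp del: jump_time.simps)
  qed
  finally show ?thesis .
qed

text \<open>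
  Time spent in \<open>y\<close> before entering \<open>C\<close>, as a sum over the visits of the jump chain to \<open>y\<close>. The inner integral
  is the length of the holding interval. After the jump chain has been absorbed the holding times are infinite
  by convention, whence the assumption that visits to \<open>y\<close> occur at finite jump times.
\<close>

lemma occupation_time:
  assumes \<omega>: "\<omega> \<in> space M" and ne: "nonexplosive \<omega>" and "y \<notin> C"
    and fin: "\<And>n. JC n \<omega> = y \<Longrightarrow> JT n \<omega> \<noteq> \<infinity>"
  shows "(\<integral>\<^sup>+ s. indicator {s. 0 \<le> s \<and> ereal s \<le> entry_time C \<omega> \<and> Z s \<omega> = y} s \<partial>lborel)
    = (\<Sum>n. indicator {\<omega>. (\<forall>i<n. JC i \<omega> \<in> - C) \<and> JC n \<omega> = y} \<omega>
         * (\<integral>\<^sup>+ s. indicator {s. 0 \<le> s \<and> ereal s < HT n \<omega>} s \<partial>lborel))"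
proof -
  let ?A = "\<lambda>n. indicator {\<omega>. (\<forall>i<n. JC i \<omega> \<in> - C) \<and> JC n \<omega> = y} \<omega> :: ennreal"
  let ?I = "\<lambda>n s. indicator {s. JT n \<omega> \<le> ereal s \<and> ereal s < JT (Suc n) \<omega>} s :: ennreal"
  have pt: "indicator {s. 0 \<le> s \<and> ereal s \<le> entry_time C \<omega> \<and> Z s \<omega> = y} s = (\<Sum>n. ?A n * ?I n s)" for s
  proof (cases "0 \<le> s")
    case False
    have "\<not> JT n \<omega> \<le> ereal s" for n
      using False jump_time_nonneg[of n \<omega>] by (metis ereal_less_eq(5) order_trans)
    then show ?thesis using False by simp
  next
    case True
    obtain N where "ereal s < JT N \<omega>" using ne unfolding nonexplosive_def by blast
    then obtain n where n: "JT n \<omega> \<le> ereal s" "ereal s < JT (Suc n) \<omega>"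
      using jump_interval_exists[OF True] by metis
    have uniq: "m = n" if "JT m \<omega> \<le> ereal s" "ereal s < JT (Suc m) \<omega>" for m
    proof (rule ccontr)
      assume "m \<noteq> n"
      then have "Suc m \<le> n \<or> Suc n \<le> m" by auto
      then show False using jump_time_mono[of "Suc m" n \<omega>] jump_time_mono[of "Suc n" m \<omega>] that n
        by (auto simp del: jump_time.simps)
    qed
    have "(\<Sum>m. ?A m * ?I m s) = (\<Sum>m\<in>{n}. ?A m * ?I m s)"
      using uniq by (intro suminf_finite) (auto simp: indicator_def simp del: jump_time.simps)
    also have "\<dots> = ?A n" using n by (simp del: jump_time.simps)
    also have "\<dots> = indicator {s. 0 \<le> s \<and> ereal s \<le> entry_time C \<omega> \<and> Z s \<omega> = y} s"
    proof -
      have Zs: "Z s \<omega> = JC n \<omega>" by (rule Z_between_jumps[OF n])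
      have "ereal s \<le> entry_time C \<omega> \<longleftrightarrow> (\<forall>i<n. JC i \<omega> \<in> - C)" if y: "JC n \<omega> = y"
      proof
        assume le: "ereal s \<le> entry_time C \<omega>"
        show "\<forall>i<n. JC i \<omega> \<in> - C"
        proof (intro allI impI, rule ccontr)
          fix i assume i: "i < n" "JC i \<omega> \<notin> - C"
          have "JT (Suc i) \<omega> \<le> JT n \<omega>" using i(1) by (intro jump_time_mono) simp
          then have "JT (Suc i) \<omega> \<le> ereal s" using n(1) by order
          moreover have fi: "JT i \<omega> \<noteq> \<infinity>"
            using jump_time_mono1[of i \<omega>] calculation by (auto simp del: jump_time.simps)
          moreover have "entry_time C \<omega> \<le> JT i \<omega>" using i fi by (intro entry_time_le) auto
          ultimately show False using jump_time_strict[OF \<omega> fi] le by order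
        qed
      next
        assume "\<forall>i<n. JC i \<omega> \<in> - C"
        then have "JT (Suc n) \<omega> \<le> entry_time C \<omega>"
          using y \<open>y \<notin> C\<close> by (intro entry_time_ge) (auto simp: less_Suc_eq)
        then show "ereal s \<le> entry_time C \<omega>" using n(2) by order
      qed
      then show ?thesis using True Zs by (auto simp: indicator_def)
    qed
    finally show ?thesis by simp
  qed
  have "(\<integral>\<^sup>+ s. indicator {s. 0 \<le> s \<and> ereal s \<le> entry_time C \<omega> \<and> Z s \<omega> = y} s \<partial>lborel)
      = (\<Sum>n. \<integral>\<^sup>+ s. ?A n * ?I n s \<partial>lborel)"
    unfolding pt by (rule nn_integral_suminf) (simp del: jump_time.simps)
  also have "\<dots> = (\<Sum>n. ?A n * (\<integral>\<^sup>+ s. indicator {s. 0 \<le> s \<and> ereal s < HT n \<omega>} s \<partial>lborel))"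
  proof (intro suminf_cong)
    fix n
    have "(\<integral>\<^sup>+ s. ?A n * ?I n s \<partial>lborel) = ?A n * (\<integral>\<^sup>+ s. ?I n s \<partial>lborel)"
      by (rule nn_integral_cmult) (simp del: jump_time.simps)
    also have "\<dots> = ?A n * (\<integral>\<^sup>+ s. indicator {s. 0 \<le> s \<and> ereal s < HT n \<omega>} s \<partial>lborel)"
    proof (cases "JC n \<omega> = y")
      case True
      show ?thesis by (subst sojourn_integral[OF \<omega> fin[OF True]]) simp
    qed simp
    finally show "(\<integral>\<^sup>+ s. ?A n * ?I n s \<partial>lborel) = ?A n * (\<integral>\<^sup>+ s. indicator {s. 0
          \<le> s \<and> ereal s < HT n \<omega>} s \<partial>lborel)" .
  qed
  finally show ?thesis .
qed

end

section \<open>The jump chain and the occupation times of a Markov chain\<close>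

text \<open>
  The transition kernel of the jump chain, as a function with values in the extended nonnegative reals.
\<close>

definition jump_kernel :: "('s \<Rightarrow> 's \<Rightarrow> real) \<Rightarrow> 's \<Rightarrow> 's \<Rightarrow> ennreal" where
  "jump_kernel g x y = ennreal (jump_prob g x y)"

text \<open>
  A continuous-time Markov chain on a countable set whose exit rates are bounded.
\<close>

locale bounded_markov_chain =
  fixes M :: "'w measure" and g :: "'s::countable \<Rightarrow> 's \<Rightarrow> real" and z :: 's
    and Z :: "real \<Rightarrow> 'w \<Rightarrow> 's" and b :: real
  assumes mc: "markov_chain M g z Z"
    and diag_nonpos: "g x x \<le> 0"
    and off_diag_nonneg: "x \<noteq> y \<Longrightarrow> 0 \<le> g x y"
    and rate_bound: "- g x x \<le> b"
begin

sublocale prob_space M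
  using mc unfolding markov_chain_def by blast

sublocale right_cont_process M Z
  using mc unfolding markov_chain_def by unfold_locales auto

lemma jump_prob_nonneg: "0 \<le> jump_prob g x y"
  using diag_nonpos[of x] off_diag_nonneg[of x y] unfolding jump_prob_def
  by (auto intro!: divide_nonneg_nonpos simp flip: minus_divide_right)

text \<open>
  The probability that the first \<open>n + 1\<close> states of the jump chain are \<open>y 0, \<dots>, y n\<close>.
\<close>

definition path_prob :: "nat \<Rightarrow> (nat \<Rightarrow> 's) \<Rightarrow> real" where
  "path_prob n y = (if y 0 = z then 1 else 0) * (\<Prod>k<n. jump_prob g (y k) (y (Suc k)))"

lemma path_prob_nonneg: "0 \<le> path_prob n y"
  unfolding path_prob_def by (auto intro!: prod_nonneg jump_prob_nonneg)

lemma cylinder_prob: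
  assumes "\<And>k. k \<le> n \<Longrightarrow> 0 \<le> s k"
  shows "measure M {\<omega> \<in> space M. \<forall>k\<le>n. JC k \<omega> = y k \<and> ereal (s k) < HT k \<omega>}
    = path_prob n y * (\<Prod>k\<le>n. exp (g (y k) (y k) * s k))"
  using mc assms unfolding markov_chain_def path_prob_def by blast

lemma path_prob_last:
  assumes "0 \<le> s"
  shows "emeasure M {\<omega> \<in> space M. (\<forall>i\<le>k. JC i \<omega> = y i) \<and> ereal s < HT k \<omega>}
    = ennreal (path_prob k y) * ennreal (exp (g (y k) (y k) * s))"
proof -
  let ?s = "\<lambda>i. if i = k then s else 0"
  have "{\<omega> \<in> space M. (\<forall>i\<le>k. JC i \<omega> = y i) \<and> ereal s < HT k \<omega>}
      = {\<omega> \<in> space M. \<forall>i\<le>k. JC i \<omega> = y i \<and> ereal (?s i) < HT i \<omega>}"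
    using holding_time_pos by (auto simp: zero_ereal_def)
  then have "measure M {\<omega> \<in> space M. (\<forall>i\<le>k. JC i \<omega> = y i) \<and> ereal s < HT k \<omega>}
      = path_prob k y * (\<Prod>i\<le>k. exp (g (y i) (y i) * ?s i))"
    using cylinder_prob[of k ?s y] assms by simp
  also have "(\<Prod>i\<le>k. exp (g (y i) (y i) * ?s i)) = (\<Prod>i\<le>k. if i = k then exp (g (y i) (y i) * s) else 1)"
    by (intro prod.cong) auto
  also have "\<dots> = exp (g (y k) (y k) * s)" by simp
  finally show ?thesis by (simp add: emeasure_eq_measure ennreal_mult' path_prob_nonneg)
qed

text \<open>
  Conditioning on an initial segment \<open>y 0, \<dots>, y k\<close> of the jump chain makes the law of the continuation
  accessible to induction: one step extends the segment by one state.
\<close>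

lemma taboo_prob_prefix:
  assumes "0 \<le> s"
  shows "emeasure M {\<omega> \<in> space M. (\<forall>i\<le>k. JC i \<omega> = y i) \<and> (\<forall>i. k \<le> i \<and> i < k + n \<longrightarrow> JC i \<omega> \<in> B)
      \<and> JC (k + n) \<omega> = x \<and> ereal s < HT (k + n) \<omega>}
    = ennreal (path_prob k y) * taboo_kernel (jump_kernel g) B n (y k) x * ennreal (exp (g x x * s))"
proof (induction n arbitrary: k y)
  case 0
  show ?case
  proof (cases "y k = x")
    case True
    then have "{\<omega> \<in> space M. (\<forall>i\<le>k. JC i \<omega> = y i) \<and> (\<forall>i. k \<le> i \<and> i < k + 0 \<longrightarrow> JC i \<omega> \<in> B)
        \<and> JC (k + 0) \<omega> = x \<and> ereal s < HT (k + 0) \<omega>}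
        = {\<omega> \<in> space M. (\<forall>i\<le>k. JC i \<omega> = y i) \<and> ereal s < HT k \<omega>}" by auto
    with True path_prob_last[OF assms, of k y] show ?thesis by simp
  next
    case False
    then have "{\<omega> \<in> space M. (\<forall>i\<le>k. JC i \<omega> = y i) \<and> (\<forall>i. k \<le> i \<and> i < k + 0 \<longrightarrow> JC i \<omega> \<in> B)
        \<and> JC (k + 0) \<omega> = x \<and> ereal s < HT (k + 0) \<omega>} = {}" by auto
    then show ?thesis using False by (simp only: emeasure_empty) simp
  qed
next
  case (Suc n)
  let ?E = "\<lambda>k y n. {\<omega> \<in> space M. (\<forall>i\<le>k. JC i \<omega> = y i) \<and> (\<forall>i. k \<le> i \<and> i < k + n \<longrightarrow> JC i \<omega> \<in> B)
        \<and> JC (k + n) \<omega> = x \<and> ereal s < HT (k + n) \<omega>}"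
  show ?case
  proof (cases "y k \<in> B")
    case False
    then have "?E k y (Suc n) = {}" by force
    then show ?thesis using False by (simp only: emeasure_empty) simp
  next
    case True
    have E: "?E k y (Suc n) = (\<Union>w. ?E (Suc k) (y(Suc k := w)) n)"
    proof (intro set_eqI iffI)
      fix \<omega> assume "\<omega> \<in> ?E k y (Suc n)"
      then have "\<omega> \<in> ?E (Suc k) (y(Suc k := JC (Suc k) \<omega>)) n"
        by (auto simp: le_Suc_eq simp del: jump_chain.simps)
      then show "\<omega> \<in> (\<Union>w. ?E (Suc k) (y(Suc k := w)) n)" by blast
    next
      fix \<omega> assume "\<omega> \<in> (\<Union>w. ?E (Suc k) (y(Suc k := w)) n)"
      then obtain w where \<omega>: "\<omega> \<in> ?E (Suc k) (y(Suc k := w)) n" by blast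
      have 1: "JC i \<omega> = y i" if "i \<le> k" for i
      proof -
        have "JC i \<omega> = (y(Suc k := w)) i" using \<omega> that by (auto simp del: jump_chain.simps)
        then show ?thesis using that by auto
      qed
      have 2: "JC i \<omega> \<in> B" if "k \<le> i" "i < k + Suc n" for i
        using 1[of k] True \<omega> that by (cases "i = k") (auto simp del: jump_chain.simps)
      show "\<omega> \<in> ?E k y (Suc n)" using \<omega> 1 2 by (auto simp del: jump_chain.simps)
    qed
    have last: "JC (Suc k) \<omega> = w" if "\<omega> \<in> ?E (Suc k) (y(Suc k := w)) n" for w \<omega>
    proof -
      from that have "\<forall>i\<le>Suc k. JC i \<omega> = (y(Suc k := w)) i" by blast
      then have "JC (Suc k) \<omega> = (y(Suc k := w)) (Suc k)" by blast
      then show ?thesis by (simp del: jump_chain.simps)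
    qed
    have "emeasure M (?E k y (Suc n)) = (\<integral>\<^sup>+ w. emeasure M (?E (Suc k) (y(Suc k := w)) n) \<partial>count_space UNIV)"
      unfolding E
    proof (rule emeasure_UN_countable)
      show "disjoint_family (\<lambda>w. ?E (Suc k) (y(Suc k := w)) n)"
        unfolding disjoint_family_on_def
      proof (intro ballI impI)
        fix w w' :: 's assume "w \<noteq> w'"
        then show "?E (Suc k) (y(Suc k := w)) n \<inter> ?E (Suc k) (y(Suc k := w')) n = {}"
          using last[of _ w] last[of _ w'] by blast
      qed
      show "?E (Suc k) (y(Suc k := w)) n \<in> sets M" for w
        by measurable
    qed (rule countableI_type)
    also have "\<dots> = (\<integral>\<^sup>+ w. ennreal (path_prob k y) * (jump_kernel g (y k) w
          * taboo_kernel (jump_kernel g) B n w x)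
        * ennreal (exp (g x x * s)) \<partial>count_space UNIV)"
    proof (intro nn_integral_cong)
      fix w
      have pp: "path_prob (Suc k) (y(Suc k := w)) = path_prob k y * jump_prob g (y k) w"
        unfolding path_prob_def by simp
      show "emeasure M (?E (Suc k) (y(Suc k := w)) n)
        = ennreal (path_prob k y) * (jump_kernel g (y k) w * taboo_kernel
              (jump_kernel g) B n w x) * ennreal (exp (g x x * s))"
        unfolding Suc.IH pp by
              (simp add: jump_kernel_def ennreal_mult path_prob_nonneg jump_prob_nonneg mult.assoc)
    qed
    also have "\<dots> = ennreal (path_prob k y) * taboo_kernel (jump_kernel g) B (Suc n) (y k) x
          * ennreal (exp (g x x * s))"
      using True by (simp add: nn_integral_cmult nn_integral_multc)
    finally show ?thesis .
  qed
qed

lemma AE_start: "AE \<omega> in M. JC 0 \<omega> = z"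
proof -
  have "prob {\<omega> \<in> space M. JC 0 \<omega> = z} = 1"
    using path_prob_last[of 0 0 "\<lambda>_. z"] holding_time_pos
    by (auto simp: path_prob_def emeasure_eq_measure zero_ereal_def cong: conj_cong Collect_cong)
  then show ?thesis by (subst (asm) prob_Collect_eq_1) (simp_all del: jump_chain.simps)
qed

lemma taboo_prob:
  assumes "0 \<le> s"
  shows "emeasure M {\<omega> \<in> space M. (\<forall>i<n. JC i \<omega> \<in> B) \<and> JC n \<omega> = x \<and> ereal s < HT n \<omega>}
    = taboo_kernel (jump_kernel g) B n z x * ennreal (exp (g x x * s))"
proof -
  have "emeasure M {\<omega> \<in> space M. (\<forall>i<n. JC i \<omega> \<in> B) \<and> JC n \<omega> = x \<and> ereal s < HT n \<omega>}
      = emeasure M {\<omega> \<in> space M. (\<forall>i\<le>0. JC i \<omega> = z) \<and> (\<forall>i. 0 \<le> i \<and> i < 0 + n \<longrightarrow> JC i \<omega> \<in> B)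
      \<and> JC (0 + n) \<omega> = x \<and> ereal s < HT (0 + n) \<omega>}"
  proof (rule emeasure_eq_AE)
    show "AE \<omega> in M. (\<omega> \<in> {\<omega> \<in> space M. (\<forall>i<n. JC i \<omega> \<in> B) \<and> JC n \<omega> = x \<and> ereal s < HT n \<omega>})
      = (\<omega> \<in> {\<omega> \<in> space M. (\<forall>i\<le>0. JC i \<omega> = z) \<and> (\<forall>i. 0 \<le> i \<and> i < 0 + n \<longrightarrow> JC i \<omega> \<in> B)
      \<and> JC (0 + n) \<omega> = x \<and> ereal s < HT (0 + n) \<omega>})"
      using AE_start by eventually_elim auto
  qed measurable
  also have "\<dots> = taboo_kernel (jump_kernel g) B n z x * ennreal (exp (g x x * s))"
    by (subst taboo_prob_prefix[OF assms]) (simp add: path_prob_def)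
  finally show ?thesis .
qed

lemma taboo_prob_0:
  "emeasure M {\<omega> \<in> space M. (\<forall>i<n. JC i \<omega> \<in> B) \<and> JC n \<omega> = x} = taboo_kernel (jump_kernel g) B n z x"
proof -
  have "{\<omega> \<in> space M. (\<forall>i<n. JC i \<omega> \<in> B) \<and> JC n \<omega> = x}
      = {\<omega> \<in> space M. (\<forall>i<n. JC i \<omega> \<in> B) \<and> JC n \<omega> = x \<and> ereal 0 < HT n \<omega>}"
    using holding_time_pos by (auto simp: zero_ereal_def)
  then show ?thesis using taboo_prob[of 0 n B x] by simp
qed

text \<open>
  The law of the chain is given through joint tails of the holding times. Bounding a holding time above by
  \<open>1\<close> amounts to subtracting the tail at \<open>1\<close> in the corresponding coordinate; this is done for the coordinates
  in \<open>K\<close>, one at a time.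
\<close>

lemma holding_le_1_prob:
  assumes "finite K" "K \<subseteq> {..n}" "\<And>k. k \<le> n \<Longrightarrow> 0 \<le> s k" "\<And>k. k \<in> K \<Longrightarrow> s k = 0"
  shows "measure M {\<omega> \<in> space M. \<forall>k\<le>n. JC k \<omega> = y k \<and> ereal (s k) < HT k \<omega> \<and> (k \<in> K \<longrightarrow> HT k \<omega> \<le> 1)}
    = path_prob n y * (\<Prod>k\<le>n. exp (g (y k) (y k) * s k) - (if k \<in> K then exp (g (y k) (y k)) else 0))"
  using assms
proof (induction K arbitrary: s)
  case empty
  then show ?case using cylinder_prob[of n s y] by simp
next
  case (insert m K)
  let ?E = "\<lambda>s K. {\<omega> \<in> space M. \<forall>k\<le>n. JC k \<omega> = y k \<and> ereal (s k) < HT k \<omega> \<and> (k \<in> K \<longrightarrow> HT k \<omega> \<le> 1)}"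
  let ?t = "\<lambda>s K k. exp (g (y k) (y k) * s k) - (if k \<in> K then exp (g (y k) (y k)) else 0)"
  let ?s1 = "s(m := 1)"
  have m: "m \<le> n" "s m = 0" using insert.prems by auto
  have split: "?E s (insert m K) = ?E s K - ?E ?s1 K"
  proof (intro set_eqI iffI)
    fix \<omega> assume \<omega>: "\<omega> \<in> ?E s (insert m K)"
    have "HT m \<omega> \<le> 1" using \<omega> m(1) by blast
    then have "\<not> ereal (?s1 m) < HT m \<omega>" by (simp add: one_ereal_def not_less)
    then have "\<omega> \<notin> ?E ?s1 K" using m(1) by blast
    then show "\<omega> \<in> ?E s K - ?E ?s1 K" using \<omega> by blast
  next
    fix \<omega> assume \<omega>: "\<omega> \<in> ?E s K - ?E ?s1 K"
    then obtain k where k: "k \<le> n" "\<not> ereal (?s1 k) < HT k \<omega>" by blast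
    have "k = m"
    proof (rule ccontr)
      assume "k \<noteq> m"
      then have "?s1 k = s k" by simp
      with k \<omega> show False by auto
    qed
    then have "HT m \<omega> \<le> 1" using k(2) by (simp add: one_ereal_def not_less)
    then show "\<omega> \<in> ?E s (insert m K)" using \<omega> by blast
  qed
  have sub: "?E ?s1 K \<subseteq> ?E s K"
  proof
    fix \<omega> assume \<omega>: "\<omega> \<in> ?E ?s1 K"
    have "ereal (s k) < HT k \<omega>" if "k \<le> n" for k
    proof (cases "k = m")
      case True
      have "\<omega> \<in> space M" using \<omega> by simp
      then show ?thesis using True m(2) holding_time_pos[of \<omega> m] by (simp add: zero_ereal_def)
    next
      case False
      have "ereal (?s1 k) < HT k \<omega>" using \<omega> that by blast
      then show ?thesis using False by simp
    qed
    then show "\<omega> \<in> ?E s K" using \<omega> by auto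
  qed
  have "measure M (?E s (insert m K)) = measure M (?E s K) - measure M (?E ?s1 K)"
    unfolding split by (rule finite_measure_Diff[OF _ _ sub]) measurable
  also have "measure M (?E s K) = path_prob n y * (\<Prod>k\<le>n. ?t s K k)"
    using insert.prems by (intro insert.IH) auto
  also have "measure M (?E ?s1 K) = path_prob n y * (\<Prod>k\<le>n. ?t ?s1 K k)"
    using insert.prems insert.hyps by (intro insert.IH) auto
  also have "(\<Prod>k\<le>n. ?t s K k) = (\<Prod>k\<in>{..n}-{m}. ?t s K k) * 1"
    using m insert.hyps by (subst prod.remove[of _ m]) auto
  also have "(\<Prod>k\<le>n. ?t ?s1 K k) = (\<Prod>k\<in>{..n}-{m}. ?t s K k) * exp (g (y m) (y m))"
    using m insert.hyps by (subst prod.remove[of _ m]) (auto intro!: prod.cong)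
  also have "path_prob n y * ((\<Prod>k\<in>{..n}-{m}. ?t s K k) * 1)
      - path_prob n y * ((\<Prod>k\<in>{..n}-{m}. ?t s K k) * exp (g (y m) (y m)))
    = path_prob n y * ((1 - exp (g (y m) (y m))) * (\<Prod>k\<in>{..n}-{m}. ?t s K k))"
    by (simp add: algebra_simps)
  also have "(1 - exp (g (y m) (y m))) * (\<Prod>k\<in>{..n}-{m}. ?t s K k) = (\<Prod>k\<le>n. ?t s (insert m K) k)"
    using m by (subst prod.remove[of "{..n}" m]) (auto intro!: prod.cong)
  finally show ?case .
qed

text \<open>
  Given the past, a holding time is at most \<open>1\<close> with probability at most \<open>1 - exp (- b)\<close>.
\<close>

lemma short_holding_decay:
  "measure M {\<omega> \<in> space M. \<forall>j. m \<le> j \<and> j < m + n \<longrightarrow> HT j \<omega> \<le> 1} \<le> (1 - exp (- b)) ^ n"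
proof (induction n)
  case 0
  show ?case by simp
next
  case (Suc n)
  let ?c = "1 - exp (- b)"
  let ?E = "\<lambda>n. {\<omega> \<in> space M. \<forall>j. m \<le> j \<and> j < m + n \<longrightarrow> HT j \<omega> \<le> 1}"
  \<comment> \<open>The states visited so far form a list, that is, a random variable with countably many values.\<close>
  let ?Y = "\<lambda>\<omega>. map (\<lambda>k. JC k \<omega>) [0..<Suc (m + n)]"
  let ?A = "\<lambda>n ys. {\<omega> \<in> ?E n. ?Y \<omega> = ys}"
  have b0: "0 \<le> b" using diag_nonpos[of z] rate_bound[of z] by linarith
  have c0: "0 \<le> ?c" using b0 by simp
  have Y: "?Y \<omega> = ys \<longleftrightarrow> length ys = Suc (m + n) \<and> (\<forall>k\<le>m+n. JC k \<omega> = ys ! k)" for ys \<omega>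
    by (auto simp: list_eq_iff_nth_eq less_Suc_eq_le simp del: jump_chain.simps upt_Suc)
  have meas [measurable]: "?A l ys \<in> sets M" for l ys
    unfolding Y by measurable
  have sum: "emeasure M (?E l) = (\<integral>\<^sup>+ ys. emeasure M (?A l ys) \<partial>count_space UNIV)" for l
  proof -
    have "?E l = (\<Union>ys. ?A l ys)" by blast
    then have "emeasure M (?E l) = emeasure M (\<Union>ys. ?A l ys)" by simp
    also have "\<dots> = (\<integral>\<^sup>+ ys. emeasure M (?A l ys) \<partial>count_space UNIV)"
    proof (rule emeasure_UN_countable)
      show "disjoint_family (?A l)" unfolding disjoint_family_on_def by blast
    qed (rule meas, rule countableI_type)
    finally show ?thesis .
  qed
  have step: "emeasure M (?A (Suc n) ys) \<le> ennreal ?c * emeasure M (?A n ys)" for ys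
  proof (cases "length ys = Suc (m + n)")
    case False
    then have "?A (Suc n) ys = {}" using Y by blast
    then show ?thesis by (simp only: emeasure_empty zero_le)
  next
    case True
    let ?y = "\<lambda>k. ys ! k"
    have A: "?A l ys = {\<omega> \<in> space M. \<forall>k\<le>m+n. JC k \<omega> = ?y k \<and> ereal 0 < HT k \<omega> \<and> (k \<in> {m..<m+l} \<longrightarrow> HT k \<omega> \<le> 1)}"
      if "l \<le> Suc n" for l
      unfolding Y using True that holding_time_pos by (auto simp: zero_ereal_def)
    let ?f = "\<lambda>l k. exp (g (?y k) (?y k) * 0) - (if k \<in> {m..<m+l} then exp (g (?y k) (?y k)) else 0)"
    have P: "measure M (?A l ys) = path_prob (m+n) ?y * (\<Prod>k\<le>m+n. ?f l k)" if "l \<le> Suc n" for l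
      unfolding A[OF that] using that by (intro holding_le_1_prob) auto
    have f0: "0 \<le> ?f l k" for l k using diag_nonpos[of "?y k"] by auto
    have "(\<Prod>k\<le>m+n. ?f (Suc n) k) = (1 - exp (g (?y (m+n)) (?y (m+n)))) * (\<Prod>k\<le>m+n. ?f n k)"
      by (subst (1 2) prod.remove[of _ "m+n"]) (auto intro!: prod.cong)
    then have "measure M (?A (Suc n) ys) = (1 - exp (g (?y (m+n)) (?y (m+n)))) * measure M (?A n ys)"
      using P[of n] P[of "Suc n"] by simp
    also have "\<dots> \<le> ?c * measure M (?A n ys)"
      using rate_bound[of "?y (m+n)"] by (intro mult_right_mono) auto
    finally show ?thesis using c0 by (simp add: emeasure_eq_measure flip: ennreal_mult)
  qed
  have "emeasure M (?E (Suc n)) \<le> (\<integral>\<^sup>+ ys. ennreal ?c * emeasure M (?A n ys) \<partial>count_space UNIV)"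
    unfolding sum[of "Suc n"] by (intro nn_integral_mono step)
  also have "\<dots> = ennreal ?c * emeasure M (?E n)"
    unfolding sum[of n] by (rule nn_integral_cmult) simp
  finally have "measure M (?E (Suc n)) \<le> ?c * measure M (?E n)"
    using c0 by (simp add: emeasure_eq_measure flip: ennreal_mult)
  also have "\<dots> \<le> ?c * ?c ^ n" using Suc c0 by (intro mult_left_mono) auto
  finally show ?case by simp
qed

text \<open>
  Almost surely infinitely many holding times exceed \<open>1\<close>.
\<close>

lemma AE_nonexplosive: "AE \<omega> in M. nonexplosive \<omega>"
proof -
  have "AE \<omega> in M. \<not> (\<forall>j\<ge>m. HT j \<omega> \<le> 1)" for m
  proof -
    let ?F = "{\<omega> \<in> space M. \<forall>j\<ge>m. HT j \<omega> \<le> 1}"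
    have b0: "0 \<le> b" using diag_nonpos[of z] rate_bound[of z] by linarith
    have le: "measure M ?F \<le> (1 - exp (- b)) ^ n" for n
    proof -
      have "measure M ?F \<le> measure M {\<omega> \<in> space M. \<forall>j. m \<le> j \<and> j < m + n \<longrightarrow> HT j \<omega> \<le> 1}"
        by (intro finite_measure_mono) auto
      also have "\<dots> \<le> (1 - exp (- b)) ^ n" by (rule short_holding_decay)
      finally show ?thesis .
    qed
    have "(\<lambda>n. (1 - exp (- b)) ^ n) \<longlonglongrightarrow> 0"
      using b0 by (intro LIMSEQ_power_zero) auto
    then have "measure M ?F \<le> 0"
      using le by (intro LIMSEQ_le_const) auto
    then have "measure M ?F = 0" by (simp add: measure_le_0_iff)
    then have "emeasure M ?F = 0" by (simp add: emeasure_eq_measure)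
    then have "?F \<in> null_sets M" by (intro null_setsI) measurable
    then show ?thesis by (rule AE_I'[where N = ?F]) auto
  qed
  then have "AE \<omega> in M. \<forall>m. \<not> (\<forall>j\<ge>m. HT j \<omega> \<le> 1)" by (subst AE_all_countable) blast
  then show ?thesis
  proof eventually_elim
    case (elim \<omega>)
    then show ?case by (intro nonexplosiveI) (metis not_le)
  qed
qed

text \<open>
  An infinite jump time forces an infinite holding time, which has probability zero in a state with positive
  exit rate.
\<close>

lemma AE_finite_jump_time:
  assumes "g x x < 0"
  shows "AE \<omega> in M. JC n \<omega> = x \<longrightarrow> JT n \<omega> \<noteq> \<infinity>"
proof -
  let ?F = "{\<omega> \<in> space M. JC n \<omega> = x \<and> HT n \<omega> = \<infinity>}"
  have [measurable]: "Measurable.pred M (\<lambda>\<omega>. HT n \<omega> = \<infinity>)"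
  proof -
    have inf: "{\<infinity>::ereal} \<in> sets borel" by (rule borel_closed[OF closed_singleton])
    have eq: "{\<omega> \<in> space M. HT n \<omega> = \<infinity>} = holding_time Z n -` {\<infinity>} \<inter> space M" by auto
    show ?thesis
      unfolding pred_def eq by (rule measurable_sets[OF holding_time_measurable inf])
  qed
  have le: "emeasure M ?F \<le> taboo_kernel (jump_kernel g) UNIV n z x * ennreal (exp (g x x * real s))"
        for s :: nat
    unfolding taboo_prob[OF of_nat_0_le_iff, symmetric] by (intro emeasure_mono) auto
  have fin: "taboo_kernel (jump_kernel g) UNIV n z x < \<top>"
    unfolding taboo_prob_0[symmetric] by (simp add: emeasure_eq_measure)
  have "(\<lambda>s. exp (g x x * real s)) \<longlonglongrightarrow> 0"
  proof -
    have "(\<lambda>s. exp (g x x) ^ s) \<longlonglongrightarrow> 0" using assms by (intro LIMSEQ_power_zero) auto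
    then show ?thesis by (simp add: exp_of_nat_mult[symmetric] mult.commute)
  qed
  then have "(\<lambda>s. taboo_kernel (jump_kernel g) UNIV n z x * ennreal (exp (g x x * real s)))
      \<longlonglongrightarrow> taboo_kernel (jump_kernel g) UNIV n z x * ennreal 0"
    using fin by (intro ennreal_tendsto_cmult tendsto_ennrealI)
  then have "emeasure M ?F \<le> 0"
    using le by (intro LIMSEQ_le_const) auto
  then have "?F \<in> null_sets M" by (intro null_setsI) (simp, measurable)
  then show ?thesis
    by (rule AE_I'[where N = ?F]) (auto simp: holding_time_def)
qed

text \<open>
  Conditionally on the event \<open>A\<close>, which fixes the \<open>n\<close>-th state to be \<open>x\<close>, the holding time is exponential;
  the total mass of \<open>A\<close> is \<open>q\<close>.
\<close>

lemma expected_holding: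
  assumes "g x x < 0" and [measurable]: "Measurable.pred M A" and A: "\<And>\<omega>. A \<omega> \<Longrightarrow> JC n \<omega> = x"
    and prob: "\<And>s. 0 \<le> s \<Longrightarrow> emeasure M {\<omega> \<in> space M. A \<omega> \<and> ereal s < HT n \<omega>} = q * ennreal (exp (g x x * s))"
  shows "(\<integral>\<^sup>+ \<omega>. indicator {\<omega>. A \<omega>} \<omega> * (\<integral>\<^sup>+ s. indicator {s. 0 \<le> s \<and> ereal s < HT n \<omega>} s \<partial>lborel) \<partial>M)
    = q * ennreal (1 / - g x x)"
proof -
  have "(\<integral>\<^sup>+ \<omega>. indicator {\<omega>. A \<omega>} \<omega> * (\<integral>\<^sup>+ s. indicator {s. 0 \<le> s \<and> ereal s < HT n \<omega>} s \<partial>lborel) \<partial>M)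
     = (\<integral>\<^sup>+ \<omega>. (\<integral>\<^sup>+ s. indicator {(\<omega>, s). A \<omega> \<and> 0 \<le> s \<and> ereal s < HT n \<omega>} (\<omega>, s) \<partial>lborel) \<partial>M)"
    by (subst nn_integral_cmult[symmetric]) (auto intro!: nn_integral_cong simp: indicator_def)
  also have "\<dots> = (\<integral>\<^sup>+ s. (\<integral>\<^sup>+ \<omega>. indicator {(\<omega>, s). A \<omega> \<and> 0 \<le> s \<and> ereal s < HT n \<omega>} (\<omega>, s) \<partial>M) \<partial>lborel)"
  proof -
    interpret pair_sigma_finite M lborel ..
    show ?thesis by (rule Fubini'[symmetric]) measurable
  qed
  also have "\<dots> = (\<integral>\<^sup>+ s. q * (ennreal (exp (g x x * s)) * indicator {0..} s) \<partial>lborel)"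
  proof (intro nn_integral_cong)
    fix s :: real
    have "(\<integral>\<^sup>+ \<omega>. indicator {(\<omega>, s). A \<omega> \<and> 0 \<le> s \<and> ereal s < HT n \<omega>} (\<omega>, s) \<partial>M)
      = (\<integral>\<^sup>+ \<omega>. indicator {\<omega> \<in> space M. A \<omega> \<and> ereal s < HT n \<omega>} \<omega> * indicator {0..} s \<partial>M)"
      by (intro nn_integral_cong) (auto simp: indicator_def)
    also have "\<dots> = emeasure M {\<omega> \<in> space M. A \<omega> \<and> ereal s < HT n \<omega>} * indicator {0..} s"
      by (subst nn_integral_multc) simp_all
    also have "\<dots> = q * (ennreal (exp (g x x * s)) * indicator {0..} s)"
      using prob[of s] by (auto simp: indicator_def)
    finally show "(\<integral>\<^sup>+ \<omega>. indicator {(\<omega>, s). A \<omega> \<and> 0 \<le> s \<and> ereal s < HT n \<omega>} (\<omega>, s) \<partial>M)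
      = q * (ennreal (exp (g x x * s)) * indicator {0..} s)" .
  qed
  also have "\<dots> = q * (\<integral>\<^sup>+ s. ennreal (exp (g x x * s)) * indicator {0..} s \<partial>lborel)"
    by (rule nn_integral_cmult) simp
  also have "(\<integral>\<^sup>+ s. ennreal (exp (g x x * s)) * indicator {0..} s \<partial>lborel)
        = ennreal (0 - exp (g x x * 0) / g x x)"
  proof (rule nn_integral_FTC_atLeast)
    show "((\<lambda>s. exp (g x x * s) / g x x) \<longlongrightarrow> 0) at_top"
    proof -
      have "((\<lambda>s. exp (g x x * s)) \<longlongrightarrow> 0) at_top"
        using assms(1) by (intro filterlim_compose[OF exp_at_bot] filterlim_tendsto_neg_mult_at_bot[OF tendsto_const _ filterlim_ident])
      from tendsto_divide[OF this tendsto_const[of "g x x"]] show ?thesis using assms(1) by simp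
    qed
  qed (use assms(1) in \<open>auto intro!: derivative_eq_intros\<close>)
  finally show ?thesis by simp
qed

lemma expected_occupation_time:
  assumes "g x x < 0" "x \<notin> C"
  shows "(\<integral>\<^sup>+ \<omega>. (\<integral>\<^sup>+ s. indicator {s. 0 \<le> s \<and> ereal s \<le> entry_time C \<omega> \<and> Z s \<omega> = x} s \<partial>lborel) \<partial>M)
    = (\<Sum>n. taboo_kernel (jump_kernel g) (- C) n z x) * ennreal (1 / - g x x)"
proof -
  let ?A = "\<lambda>n. {\<omega>. (\<forall>i<n. JC i \<omega> \<in> - C) \<and> JC n \<omega> = x}"
  have "AE \<omega> in M. \<forall>n. JC n \<omega> = x \<longrightarrow> JT n \<omega> \<noteq> \<infinity>"
    using AE_finite_jump_time[OF assms(1)] by (subst AE_all_countable) blast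
  then have "(\<integral>\<^sup>+ \<omega>. (\<integral>\<^sup>+ s. indicator {s. 0 \<le> s \<and> ereal s \<le> entry_time C \<omega> \<and> Z s \<omega> = x} s \<partial>lborel) \<partial>M)
    = (\<integral>\<^sup>+ \<omega>. (\<Sum>n. indicator (?A n) \<omega> * (\<integral>\<^sup>+ s. indicator {s. 0 \<le> s \<and> ereal s < HT n \<omega>} s \<partial>lborel)) \<partial>M)"
    using AE_nonexplosive AE_space
    by (intro nn_integral_cong_AE, eventually_elim) (rule occupation_time[OF _ _ assms(2)], blast+)
  also have "\<dots> = (\<Sum>n. \<integral>\<^sup>+ \<omega>. indicator (?A n) \<omega> * (\<integral>\<^sup>+ s. indicator {s. 0
        \<le> s \<and> ereal s < HT n \<omega>} s \<partial>lborel) \<partial>M)"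
  proof (rule nn_integral_suminf)
    fix n
    have [measurable]: "(\<lambda>\<omega>. indicator (?A n) \<omega> :: ennreal) \<in> borel_measurable M" by measurable
    show "(\<lambda>\<omega>. indicator (?A n) \<omega> * (\<integral>\<^sup>+ s. indicator {s. 0
          \<le> s \<and> ereal s < HT n \<omega>} s \<partial>lborel)) \<in> borel_measurable M"
      by measurable
  qed
  also have "\<dots> = (\<Sum>n. taboo_kernel (jump_kernel g) (- C) n z x * ennreal (1 / - g x x))"
  proof (intro suminf_cong expected_holding[OF assms(1)])
    fix n s assume "0 \<le> (s::real)"
    from taboo_prob[OF this, of n "- C" x]
    show "emeasure M {\<omega> \<in> space M. ((\<forall>i<n. JC i \<omega> \<in> - C) \<and> JC n \<omega> = x) \<and> ereal s < HT n \<omega>}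
      = taboo_kernel (jump_kernel g) (- C) n z x * ennreal (exp (g x x * s))" by (simp add: conj_assoc)
  qed (measurable, auto)
  also have "\<dots> = (\<Sum>n. taboo_kernel (jump_kernel g) (- C) n z x) * ennreal (1 / - g x x)" by simp
  finally show ?thesis .
qed

text \<open>
  The taboo set excludes both the target \<open>C\<close> and the forbidden set \<open>U\<close>, so that the \<open>n\<close>-th term is the
  probability that the jump chain enters \<open>C\<close> for the first time at step \<open>n\<close>, at \<open>x\<close>, not having met \<open>U\<close>.
\<close>

lemma first_hit_prob:
  assumes disj: "C \<inter> U = {}" and x: "x \<in> C"
  shows "emeasure M {\<omega> \<in> space M. entry_time C \<omega> < entry_time U \<omega> \<and> Z (real_of_ereal (entry_time C \<omega>)) \<omega> = x}
    = (\<Sum>n. taboo_kernel (jump_kernel g) (- U - C) n z x)"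
proof -
  let ?A = "\<lambda>n. {\<omega> \<in> space M. (\<forall>i<n. JC i \<omega> \<in> - U - C) \<and> JC n \<omega> = x}"
  have "0 \<le> entry_time C \<omega>" for \<omega> unfolding entry_time_def by (rule Inf_greatest) auto
  then have [measurable]: "(\<lambda>\<omega>. Z (real_of_ereal (entry_time C \<omega>)) \<omega>) \<in> M \<rightarrow>\<^sub>M count_space UNIV"
    by (intro Z_at_time_measurable) measurable
  have "emeasure M {\<omega> \<in> space M. entry_time C \<omega> < entry_time U \<omega> \<and> Z (real_of_ereal (entry_time C \<omega>)) \<omega> = x}
      = emeasure M (\<Union>n. ?A n)"
  proof (rule emeasure_eq_AE)
    show "AE \<omega> in M. (\<omega> \<in> {\<omega> \<in> space M. entry_time C \<omega> < entry_time U \<omega> \<and> Z (real_of_ereal (entry_time C \<omega>)) \<omega> = x})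
      = (\<omega> \<in> (\<Union>n. ?A n))"
      using AE_nonexplosive AE_space
    proof eventually_elim
      case (elim \<omega>)
      from first_hit_iff[OF elim(2,1) disj x] elim(2) show ?case by auto
    qed
  qed measurable
  also have "\<dots> = (\<Sum>n. emeasure M (?A n))"
  proof (rule suminf_emeasure[symmetric])
    show "disjoint_family ?A"
      unfolding disjoint_family_on_def
    proof (intro ballI impI)
      fix m n :: nat assume "m \<noteq> n"
      then consider "m < n" | "n < m" by linarith
      then show "?A m \<inter> ?A n = {}" using x by cases (auto simp del: jump_chain.simps)
    qed
    show "range ?A \<subseteq> sets M" by (rule image_subsetI) measurable
  qed
  also have "\<dots> = (\<Sum>n. taboo_kernel (jump_kernel g) (- U - C) n z x)"
    unfolding taboo_prob_0 ..
  finally show ?thesis .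
qed

lemma jump_kernel_total: "(\<integral>\<^sup>+ w. jump_kernel g z w \<partial>count_space UNIV) \<le> 1"
proof -
  let ?A = "\<lambda>w. {\<omega> \<in> space M. JC 1 \<omega> = w}"
  have "emeasure M (?A w) = jump_kernel g z w" for w
    using taboo_prob_0[of 1 UNIV w]
    by (simp add: nn_integral_count_space_point del: jump_chain.simps)
  then have "(\<integral>\<^sup>+ w. jump_kernel g z w \<partial>count_space UNIV) = (\<integral>\<^sup>+ w. emeasure M (?A w) \<partial>count_space UNIV)"
    by (simp del: jump_chain.simps)
  also have "\<dots> = emeasure M (\<Union>w. ?A w)"
  proof (rule emeasure_UN_countable[symmetric])
    show "?A w \<in> events" for w by measurable
    show "disjoint_family ?A" unfolding disjoint_family_on_def by blast
  qed (rule countableI_type)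
  also have "\<dots> \<le> 1" by (rule emeasure_le_1)
  finally show ?thesis .
qed

end

section \<open>Matrix series, matrix powers and sets of levels\<close>

lemma matrix_sums_iff:
  fixes f :: "nat \<Rightarrow> real^'n^'m"
  shows "f sums s \<longleftrightarrow> (\<forall>i j. (\<lambda>n. f n $ i $ j) sums (s $ i $ j))"
proof
  assume "f sums s"
  then show "\<forall>i j. (\<lambda>n. f n $ i $ j) sums (s $ i $ j)"
    unfolding sums_def using tendsto_vec_nth[OF tendsto_vec_nth] by (fastforce simp: sum_component)
next
  assume "\<forall>i j. (\<lambda>n. f n $ i $ j) sums (s $ i $ j)"
  then show "f sums s"
    unfolding sums_def by (intro vec_tendstoI) (simp add: sum_component)
qed

lemma matrix_pow_0 [simp]: "matrix_pow M 0 = mat 1"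
  and matrix_pow_Suc: "matrix_pow M (Suc k) = M ** matrix_pow M k"
  by (simp_all add: matrix_pow_def)

lemma matrix_pow_add: "matrix_pow M (m + n) = matrix_pow M m ** matrix_pow M n"
  by (induction m) (simp_all add: matrix_pow_Suc matrix_mul_assoc)

lemma matrix_pow_nonneg:
  fixes M :: "real^'n^'n"
  assumes "0 \<le> M"
  shows "0 \<le> matrix_pow M k $ i $ j"
proof (induction k arbitrary: i j)
  case 0
  show ?case by (simp add: mat_def)
next
  case (Suc k)
  then show ?case using assms
    by (auto simp: matrix_pow_Suc matrix_matrix_mult_def less_eq_vec_def intro!: sum_nonneg)
qed

text \<open>
  States are pairs of a level and a phase, or \<open>None\<close> for the cemetery. The three sets below are the states at
  level \<open>x\<close>, at level \<open>x\<close> or above, and strictly below \<open>x\<close>. None of them contains the cemetery; the complement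
  of \<open>up_set x\<close> does.
\<close>

definition level_set :: "int \<Rightarrow> (int \<times> 'n) option set" where
  "level_set x = (\<lambda>j. Some (x, j)) ` UNIV"

definition up_set :: "int \<Rightarrow> (int \<times> 'n) option set" where
  "up_set x = {Some (k, j) | k j. x \<le> k}"

definition low_set :: "int \<Rightarrow> (int \<times> 'n) option set" where
  "low_set x = {Some (k, j) | k j. k < x}"

text \<open>
  Translation of the level by \<open>h\<close>, fixing the cemetery.
\<close>

definition translate :: "int \<Rightarrow> (int \<times> 'n) option \<Rightarrow> (int \<times> 'n) option" where
  "translate h = map_option (\<lambda>(k, j). (k + h, j))"

lemma Some_mem_simps [simp]:
  "Some (k, j) \<in> level_set x \<longleftrightarrow> k = x" "Some (k, j) \<in> up_set x \<longleftrightarrow> x \<le> k" "Some (k, j) \<in> low_set x \<longleftrightarrow> k < x"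
  "None \<notin> level_set x" "None \<notin> up_set x" "None \<notin> low_set x"
  by (auto simp: level_set_def up_set_def low_set_def)

lemma translate_simps [simp]:
  "translate h None = None" "translate h (Some (k, j)) = Some (k + h, j)"
  by (simp_all add: translate_def)

lemma translate_translate: "translate h (translate (- h) x) = x" "translate (- h) (translate h x) = x"
  by (cases x; auto)+

lemma bij_translate: "bij (translate h)"
  by (rule bij_betw_byWitness[where f' = "translate (- h)"]) (auto simp: translate_translate)

lemma translate_image: "translate h ` S = {y. translate (- h) y \<in> S}"
proof (intro set_eqI iffI)
  fix y assume "y \<in> {y. translate (- h) y \<in> S}"
  then have "translate h (translate (- h) y) \<in> translate h ` S" by blast
  then show "y \<in> translate h ` S" by (simp add: translate_translate)
qed (auto simp: translate_translate)

lemma translate_Compl_up_set: "translate h ` (- up_set x) = - up_set (x + h)"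
proof (intro set_eqI)
  fix y :: "(int \<times> 'n) option"
  show "y \<in> translate h ` (- up_set x) \<longleftrightarrow> y \<in> - up_set (x + h)"
    unfolding translate_image by (cases y) auto
qed

lemma translate_low_set: "translate h ` low_set x = low_set (x + h)"
proof (intro set_eqI)
  fix y :: "(int \<times> 'n) option"
  show "y \<in> translate h ` low_set x \<longleftrightarrow> y \<in> low_set (x + h)"
    unfolding translate_image by (cases y) auto
qed

lemma finite_level_set [simp]: "finite (level_set x :: (int \<times> 'n::finite) option set)"
  by (simp add: level_set_def)

lemma sum_level_set: "(\<Sum>f\<in>level_set x. F f) = (\<Sum>k\<in>UNIV. F (Some (x, k :: 'n::finite)))"
  unfolding level_set_def by (subst sum.reindex) (auto intro: injI)

text \<open>
  The sum over all states of a function supported by the levels \<open>0, -1, -2, \<dots>\<close>.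
\<close>

lemma nn_integral_levels:
  fixes f :: "(int \<times> 'n::finite) option \<Rightarrow> ennreal"
  assumes zero: "\<And>z. z \<notin> range (\<lambda>(l, i). Some (- int l, i)) \<Longrightarrow> f z = 0"
  shows "(\<integral>\<^sup>+ z. f z \<partial>count_space UNIV) = (\<Sum>l. \<Sum>i\<in>UNIV. f (Some (- int l, i)))"
proof -
  let ?\<phi> = "\<lambda>(l, i :: 'n). Some (- int l, i)"
  have "(\<integral>\<^sup>+ z. f z \<partial>count_space UNIV) = (\<integral>\<^sup>+ z. f z \<partial>count_space (range ?\<phi>))"
    by (rule nn_integral_count_space_eq) (use zero in auto)
  also have "\<dots> = (\<integral>\<^sup>+ x. f (?\<phi> x) \<partial>count_space UNIV)"
    by (rule nn_integral_bij_count_space[symmetric]) (auto simp: bij_betw_def inj_on_def)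
  also have "\<dots> = (\<integral>\<^sup>+ l. \<integral>\<^sup>+ i. f (?\<phi> (l, i)) \<partial>count_space UNIV \<partial>count_space UNIV)"
    by (rule nn_integral_fst_count_space[symmetric])
  also have "\<dots> = (\<Sum>l. \<Sum>i\<in>UNIV. f (Some (- int l, i)))"
    by (simp add: nn_integral_count_space_nat nn_integral_count_space_finite)
  finally show ?thesis .
qed

section \<open>Skip-free Markov additive processes\<close>

text \<open>
  A lattice Markov additive process that is skip-free downward, under each of the laws \<open>P i\<close>.
\<close>

locale skip_free_map =
  fixes A :: "int \<Rightarrow> real^'n^'n"
    and P :: "'n \<Rightarrow> 'w measure" and Z :: "real \<Rightarrow> 'w \<Rightarrow> (int \<times> 'n) option"
  assumes rates: "skip_free_map_rates A"
    and chain: "markov_chain (P i) (map_generator A) (Some (0, i)) Z"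
begin

abbreviation "gen \<equiv> map_generator A"
abbreviation "p \<equiv> jump_kernel gen"

text \<open>
  The total rate at which a state of phase \<open>i\<close> is left, and the rates of genuine jumps: the diagonal of \<open>A 0\<close>
  is replaced by zero.
\<close>

definition exit_rate :: "'n \<Rightarrow> real" where "exit_rate i = - A 0 $ i $ i"

definition off_diag :: "int \<Rightarrow> 'n \<Rightarrow> 'n \<Rightarrow> real" where
  "off_diag m i j = (if m = 0 \<and> i = j then 0 else A m $ i $ j)"

lemma A_zero: "m \<le> -2 \<Longrightarrow> A m $ i $ j = 0"
  using rates unfolding skip_free_map_rates_def by simp

lemma exit_rate_pos: "0 < exit_rate i"
  using rates unfolding skip_free_map_rates_def exit_rate_def by simp

lemma off_diag_nonneg: "0 \<le> off_diag m i j"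
  using rates unfolding skip_free_map_rates_def off_diag_def by auto

lemma off_diag_zero: "m \<le> -2 \<Longrightarrow> off_diag m i j = 0"
  by (simp add: off_diag_def A_zero)

lemma kernel_Some: "p (Some (k, i)) (Some (l, j)) = ennreal (off_diag (l - k) i j / exit_rate i)"
  using exit_rate_pos[of i]
  by (auto simp: jump_kernel_def jump_prob_def off_diag_def exit_rate_def)

lemma kernel_None: "p None (Some y) = 0"
  by (simp add: jump_kernel_def jump_prob_def)

lemma kernel_translate: "p (translate h x) (translate h y) = p x y"
proof (cases x)
  case None
  show ?thesis unfolding None by (cases y) (auto simp: jump_kernel_def jump_prob_def)
next
  case (Some a)
  obtain k i where a: "a = (k, i)" by (cases a)
  show ?thesis
  proof (cases y)
    case None
    then show ?thesis unfolding Some a by (simp add: jump_kernel_def jump_prob_def)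
  next
    case (Some y')
    then show ?thesis unfolding \<open>x = Some a\<close> a by (cases y') (simp add: kernel_Some)
  qed
qed

lemma skip_free: "p z (Some (l, j)) \<noteq> 0 \<Longrightarrow> \<exists>k i. z = Some (k, i) \<and> k \<le> l + 1"
proof (cases z)
  case (Some a)
  assume nz: "p z (Some (l, j)) \<noteq> 0"
  obtain k i where a: "a = (k, i)" by (cases a)
  have "\<not> l - k \<le> -2" using nz off_diag_zero[of "l - k" i j] unfolding Some a kernel_Some by auto
  then show ?thesis using Some a by simp
qed (simp add: kernel_None)

lemma process: "bounded_markov_chain (P i) gen (Some (0, i)) Z (\<Sum>i\<in>UNIV. exit_rate i)"
proof
  show "markov_chain (P i) gen (Some (0, i)) Z" by (rule chain)
  fix x y :: "(int \<times> 'n) option"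
  have nn: "0 \<le> A m $ i $ j" if "m \<noteq> 0 \<or> i \<noteq> j" for m i j
    using rates that unfolding skip_free_map_rates_def by blast
  have kn: "0 \<le> killing_rate A $ i" for i
    using rates unfolding skip_free_map_rates_def by blast
  have le: "exit_rate i \<le> (\<Sum>i\<in>UNIV. exit_rate i)" for i
    by (rule member_le_sum) (auto intro: less_imp_le exit_rate_pos)
  show "gen x x \<le> 0"
    using exit_rate_pos by (cases x) (auto simp: exit_rate_def less_imp_le)
  show "0 \<le> gen x y" if "x \<noteq> y"
  proof (cases "(A, x, y)" rule: map_generator.cases)
    case (1 B k i l j)
    then show ?thesis using that nn[of "l - k" i j] by auto
  qed (use kn in auto)
  have "0 \<le> (\<Sum>i\<in>UNIV. exit_rate i)"
    by (intro sum_nonneg less_imp_le exit_rate_pos)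
  then show "- gen x x \<le> (\<Sum>i\<in>UNIV. exit_rate i)"
    using le by (cases x) (auto simp: exit_rate_def)
qed

text \<open>
  The row of the kernel at \<open>(0, i)\<close> is the law of the first jump under \<open>P i\<close>, so its sum is at most one;
  translation gives the other rows.
\<close>

lemma kernel_total: "(\<integral>\<^sup>+ z. p x z \<partial>count_space UNIV) \<le> 1"
proof (cases x)
  case None
  have "p None z = indicator {None} z" for z
    by (cases z) (auto simp: jump_kernel_def jump_prob_def)
  then show ?thesis unfolding None by (simp add: one_ennreal_def)
next
  case (Some a)
  obtain k i where a: "a = (k, i)" by (cases a)
  have "(\<integral>\<^sup>+ z. p x z \<partial>count_space UNIV) = (\<integral>\<^sup>+ z. p x (translate k z) \<partial>count_space UNIV)"
    by (rule nn_integral_bij_count_space[symmetric]) (rule bij_translate)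
  also have "\<dots> = (\<integral>\<^sup>+ z. p (Some (0, i)) z \<partial>count_space UNIV)"
    using kernel_translate[of k "Some (0, i)"] unfolding Some a by simp
  also have "\<dots> \<le> 1"
    by (rule bounded_markov_chain.jump_kernel_total[OF process])
  finally show ?thesis .
qed

lemma taboo_translate:
  "taboo_kernel p (- up_set (c + h)) n (Some (k + h, i)) (Some (l + h, j))
        = taboo_kernel p (- up_set c) n (Some (k, i)) (Some (l, j))"
  using taboo_bij[of "translate h" p "- up_set c" n "Some (k, i)" "Some (l, j)", OF bij_translate kernel_translate]
  by (simp add: translate_Compl_up_set)

lemma stay_translate:
  "stay_kernel p (low_set (c + h)) n (Some (k + h, i)) (Some (l + h, j))
        = stay_kernel p (low_set c) n (Some (k, i)) (Some (l, j))"
  using stay_bij[of "translate h" p "low_set c" n "Some (k, i)" "Some (l, j)", OF bij_translate kernel_translate]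
  by (simp add: translate_low_set)

text \<open>
  For the jump chain: the expected number of visits to \<open>(0, j)\<close> before the passage to level \<open>b\<close> or above,
  starting from \<open>(0, i)\<close>, for \<open>b \<ge> 1\<close>.
\<close>

definition green :: "nat \<Rightarrow> 'n \<Rightarrow> 'n \<Rightarrow> ennreal" where
  "green b i j = (\<Sum>n. taboo_kernel p (- up_set (int b)) n (Some (0, i)) (Some (0, j)))"

text \<open>
  For the jump chain: the expected number of visits to \<open>(- a, j)\<close> before the first return to level \<open>0\<close> or
  above, starting from \<open>(0, i)\<close>; for \<open>a = 0\<close> only the initial state is counted. Up to the exit rates, these are the entries of \<open>R\<^sup>a\<close>.
\<close>

definition descent :: "nat \<Rightarrow> 'n \<Rightarrow> 'n \<Rightarrow> ennreal" where
  "descent a i j = (\<Sum>n. stay_kernel p (low_set 0) n (Some (0, i)) (Some (- int a, j)))"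

text \<open>
  The probability that level \<open>- a\<close> is hit before any level \<open>\<ge> b\<close>, in phase \<open>j\<close>, starting from \<open>(0, i)\<close>,
  for \<open>b \<ge> 1\<close>.
\<close>

definition passage :: "nat \<Rightarrow> nat \<Rightarrow> 'n \<Rightarrow> 'n \<Rightarrow> ennreal" where
  "passage a b i j = (\<Sum>n. taboo_kernel p (- up_set (int b)
        - level_set (- int a)) n (Some (0, i)) (Some (- int a, j)))"

text \<open>
  The expected number of visits to \<open>(- a, j)\<close> below level \<open>b\<close>, decomposed at the first visit to level \<open>- a\<close>.
\<close>

lemma green_first_passage:
  "(\<Sum>n. taboo_kernel p (- up_set (int b)) n (Some (0, i)) (Some (- int a, j)))
        = (\<Sum>k\<in>UNIV. passage a b i k * green (a + b) k j)"
proof -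
  let ?B = "- up_set (int b)" and ?F = "level_set (- int a)" and ?x = "Some (0, i)" and ?y = "Some (- int a, j)"
  have "(\<Sum>n. taboo_kernel p ?B n ?x ?y)
      = (\<Sum>n. \<Sum>m\<le>n. \<Sum>f\<in>?F. taboo_kernel p (?B - ?F) m ?x f * taboo_kernel p ?B (n - m) f ?y)"
    by (intro suminf_cong taboo_first_entrance) auto
  also have "\<dots> = (\<Sum>f\<in>?F. \<Sum>n. \<Sum>m\<le>n. taboo_kernel p (?B - ?F) m ?x f * taboo_kernel p ?B (n - m) f ?y)"
    by (subst sum.swap) (rule suminf_sum_ennreal)
  also have "\<dots> = (\<Sum>f\<in>?F. (\<Sum>n. taboo_kernel p (?B - ?F) n ?x f) * (\<Sum>n. taboo_kernel p ?B n f ?y))"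
    by (intro sum.cong refl suminf_convolution_ennreal)
  also have "\<dots> = (\<Sum>k\<in>UNIV. passage a b i k * green (a + b) k j)"
    unfolding sum_level_set passage_def green_def
    using taboo_translate[of "int b" "int a" _ "- int a" _ "- int a"]
    by (simp add: add.commute)
  finally show ?thesis .
qed

text \<open>
  The same quantity, decomposed at the last visit to level \<open>0\<close>. As the process is skip-free downward it cannot
  reach \<open>- a\<close> from above level \<open>0\<close> without another visit to level \<open>0\<close>, so the second factor does not
  depend on \<open>b\<close>.
\<close>

lemma green_last_exit:
  assumes "1 \<le> b"
  shows "(\<Sum>n. taboo_kernel p (- up_set (int b)) n (Some (0, i)) (Some (- int a, j)))
        = (\<Sum>k\<in>UNIV. green b i k * descent a k j)"
proof -
  let ?B = "- up_set (int b)" and ?F = "level_set 0" and ?x = "Some (0, i)" and ?y = "Some (- int a, j)"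
  \<comment> \<open>Both end points lie below \<open>b\<close>, hence the two kernels agree.\<close>
  have ts: "taboo_kernel p ?B n ?x (Some (- int c, k)) = stay_kernel p ?B n ?x (Some (- int c, k))" for n c k
    using stay_kernel_eq_taboo_kernel[of ?B ?x p n "Some (- int c, k)"] assms by simp
  have "(\<Sum>n. stay_kernel p ?B n ?x ?y)
      = (\<Sum>n. \<Sum>m\<le>n. \<Sum>f\<in>?F. stay_kernel p ?B m ?x f * stay_kernel p (low_set 0) (n - m) f ?y)"
  proof (intro suminf_cong stay_last_exit)
    fix z y assume y: "y \<in> low_set 0" and nz: "p z y \<noteq> 0"
    obtain l j' where l: "y = Some (l, j')" "l < 0" using y by (auto simp: low_set_def)
    from skip_free[of z l j'] nz l obtain k i' where "z = Some (k, i')" "k \<le> l + 1" by auto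
    then show "z \<in> low_set 0 \<union> level_set 0" using l(2) by auto
  qed (use assms in \<open>auto simp: low_set_def level_set_def up_set_def\<close>)
  also have "\<dots> = (\<Sum>f\<in>?F. \<Sum>n. \<Sum>m\<le>n. stay_kernel p ?B m ?x f * stay_kernel p (low_set 0) (n - m) f ?y)"
    by (subst sum.swap) (rule suminf_sum_ennreal)
  also have "\<dots> = (\<Sum>f\<in>?F. (\<Sum>n. stay_kernel p ?B n ?x f) * (\<Sum>n. stay_kernel p (low_set 0) n f ?y))"
    by (intro sum.cong refl suminf_convolution_ennreal)
  also have "\<dots> = (\<Sum>k\<in>UNIV. green b i k * descent a k j)"
    unfolding sum_level_set green_def descent_def using ts[of _ 0] by simp
  finally show ?thesis using ts[of _ a j] by simp
qed

lemma descent_0: "descent 0 i j = (if i = j then 1 else 0)"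
proof -
  have "stay_kernel p (low_set 0) (Suc n) (Some (0, i)) (Some (0, j)) = 0" for n by simp
  then have "descent 0 i j = (\<Sum>n\<in>{0}. stay_kernel p (low_set 0) n (Some (0, i)) (Some (0, j)))"
    unfolding descent_def of_nat_0 minus_zero
    by (intro suminf_finite) (auto simp: gr0_conv_Suc simp del: stay_kernel.simps(2))
  then show ?thesis by (auto simp: indicator_def)
qed

text \<open>
  Last exit from level \<open>- 1\<close>, followed by translation by one level: the multiplicative structure behind the
  powers of \<open>R\<close>.
\<close>

lemma descent_Suc: "descent (Suc a) i j = (\<Sum>k\<in>UNIV. descent 1 i k * descent a k j)"
proof -
  let ?F = "level_set (-1)" and ?x = "Some (0, i)" and ?y = "Some (- int (Suc a), j)"
  have "descent (Suc a) i j
      = (\<Sum>n. \<Sum>m\<le>n. \<Sum>f\<in>?F. stay_kernel p (low_set 0) m ?x f * stay_kernel p (low_set (-1)) (n - m) f ?y)"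
    unfolding descent_def
  proof (intro suminf_cong stay_last_exit)
    fix z y assume y: "y \<in> low_set (-1)" and nz: "p z y \<noteq> 0"
    obtain l j' where l: "y = Some (l, j')" "l < -1" using y by (auto simp: low_set_def)
    from skip_free[of z l j'] nz l obtain k i' where "z = Some (k, i')" "k \<le> l + 1" by auto
    then show "z \<in> low_set (-1) \<union> level_set (-1)" using l(2) by auto
  qed (auto simp: low_set_def level_set_def up_set_def)
  also have "\<dots> = (\<Sum>f\<in>?F. \<Sum>n. \<Sum>m\<le>n. stay_kernel p (low_set 0) m ?x f * stay_kernel p (low_set (-1)) (n
        - m) f ?y)"
    by (subst sum.swap) (rule suminf_sum_ennreal)
  also have "\<dots> = (\<Sum>f\<in>?F. (\<Sum>n. stay_kernel p (low_set 0) n ?x f) * (\<Sum>n. stay_kernel p (low_set (-1)) n f ?y))"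
    by (intro sum.cong refl suminf_convolution_ennreal)
  also have "\<dots> = (\<Sum>k\<in>UNIV. descent 1 i k * descent a k j)"
    unfolding sum_level_set descent_def using stay_translate[of 0 "-1" _ 0 _ "- int a"]
    by (simp add: algebra_simps)
  finally show ?thesis .
qed

text \<open>
  Decomposition at the last step of a path below level \<open>0\<close>. The starting state itself, at level \<open>0\<close>, is among
  the possible predecessors.
\<close>

lemma stay_descent_step:
  assumes "1 \<le> a"
  shows "stay_kernel p (low_set 0) (Suc n) (Some (0, k)) (Some (- int a, j))
    = (\<Sum>l. \<Sum>i\<in>UNIV. stay_kernel p (low_set 0) n (Some (0, k)) (Some (- int l, i)) * ennreal (off_diag
          (int l - int a) i j / exit_rate i))"
proof -
  have "stay_kernel p (low_set 0) (Suc n) (Some (0, k)) (Some (- int a, j))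
      = (\<integral>\<^sup>+ z. stay_kernel p (low_set 0) n (Some (0, k)) z * p z (Some (- int a, j)) \<partial>count_space UNIV)"
    using assms by simp
  also have "\<dots> = (\<Sum>l. \<Sum>i\<in>UNIV. stay_kernel p (low_set 0) n (Some (0, k)) (Some (- int l, i))
        * p (Some (- int l, i)) (Some (- int a, j)))"
  proof (rule nn_integral_levels)
    fix z :: "(int \<times> 'n) option"
    assume z: "z \<notin> range (\<lambda>(l, i). Some (- int l, i))"
    show "stay_kernel p (low_set 0) n (Some (0, k)) z * p z (Some (- int a, j)) = 0"
    proof (cases z)
      case None
      then show ?thesis by (simp add: kernel_None)
    next
      case (Some w)
      obtain m i where w: "w = (m, i)" by (cases w)
      have "0 < m"
      proof (rule ccontr)
        assume "\<not> 0 < m"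
        then have "z = (\<lambda>(l, i). Some (- int l, i)) (nat (- m), i)" using Some w by simp
        with z show False by blast
      qed
      then have "stay_kernel p (low_set 0) n (Some (0, k)) z = 0" unfolding Some w by (cases n) auto
      then show ?thesis by simp
    qed
  qed
  finally show ?thesis by (simp add: kernel_Some)
qed

lemma descent_equation:
  "descent 1 k j = (\<Sum>l. \<Sum>i\<in>UNIV. descent l k i * ennreal (off_diag (int l - 1) i j / exit_rate i))"
proof -
  let ?S = "\<lambda>n l i. stay_kernel p (low_set 0) n (Some (0, k)) (Some (- int l, i))"
  let ?q = "\<lambda>l i. ennreal (off_diag (int l - 1) i j / exit_rate i)"
  have "descent 1 k j = (\<Sum>n. stay_kernel p (low_set 0) (Suc n) (Some (0, k)) (Some (- int 1, j)))"
    unfolding descent_def by (subst suminf_offset[of _ 1]) (simp_all del: stay_kernel.simps(2))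
  also have "\<dots> = (\<Sum>n. \<Sum>l. \<Sum>i\<in>UNIV. ?S n l i * ?q l i)"
    by (subst stay_descent_step) simp_all
  also have "\<dots> = (\<Sum>l. \<Sum>n. \<Sum>i\<in>UNIV. ?S n l i * ?q l i)"
    using nn_integral_count_space_swap[of "\<lambda>n l. \<Sum>i\<in>UNIV. ?S n l i * ?q l i"]
    by (simp add: nn_integral_count_space_nat)
  also have "\<dots> = (\<Sum>l. \<Sum>i\<in>UNIV. descent l k i * ?q l i)"
    unfolding descent_def suminf_sum_ennreal by simp
  finally show ?thesis .
qed

text \<open>
  The defining equation of \<open>R\<close> with the diagonal part of \<open>A 0\<close> moved to the other side; all terms are then
  nonnegative.
\<close>

lemma nonneg_solution_iff:
  "nonneg_solution A R \<longleftrightarrow> 0 \<le> R \<and>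
    (\<forall>k j. (\<lambda>l. \<Sum>i\<in>UNIV. matrix_pow R l $ k $ i * off_diag (int l - 1) i j) sums (R $ k $ j * exit_rate j))"
proof -
  have entry: "(matrix_pow R l ** A (int l - 1)) $ k $ j
      = (\<Sum>i\<in>UNIV. matrix_pow R l $ k $ i * off_diag (int l - 1) i j) -
            (if l = 1 then R $ k $ j * exit_rate j else 0)"
    for l k j
  proof -
    have "A (int l - 1) $ i $ j = off_diag (int l - 1) i j - (if l = 1 \<and> i = j then exit_rate j else 0)" for i
      by (auto simp: off_diag_def exit_rate_def)
    then have "(matrix_pow R l ** A (int l - 1)) $ k $ j
      = (\<Sum>i\<in>UNIV. matrix_pow R l $ k $ i * off_diag (int l - 1) i j -
            (if i = j then if l = 1 then matrix_pow R l $ k $ i * exit_rate j else 0 else 0))"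
      unfolding matrix_matrix_mult_def by (auto intro!: sum.cong simp: right_diff_distrib)
    also have "\<dots> = (\<Sum>i\<in>UNIV. matrix_pow R l $ k $ i * off_diag (int l - 1) i j) - (if l
          = 1 then matrix_pow R l $ k $ j * exit_rate j else 0)"
      by (simp add: sum_subtractf)
    finally show ?thesis by (auto simp: matrix_pow_Suc)
  qed
  have single: "(\<lambda>l. if l = 1 then c else 0) sums c" for c :: real
    using sums_single[of 1 "\<lambda>_. c"] by (simp add: eq_commute)
  have "(\<lambda>l. (matrix_pow R l ** A (int l - 1)) $ k $ j) sums 0
     \<longleftrightarrow> (\<lambda>l. \<Sum>i\<in>UNIV. matrix_pow R l $ k $ i * off_diag (int l - 1) i j) sums
           (R $ k $ j * exit_rate j)" for k j
    unfolding entry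
    using sums_diff[OF _ single, of _ "R $ k $ j * exit_rate j" "R $ k $ j * exit_rate j"]
      sums_add[OF _ single[of "R $ k $ j * exit_rate j"]]
    by fastforce
  then show ?thesis unfolding nonneg_solution_def matrix_sums_iff by simp
qed

text \<open>
  The equation multiplied from the left by \<open>R\<^sup>a\<^sup>-\<^sup>1\<close>. The terms with \<open>l < a - 1\<close> vanish because \<open>A m = 0\<close> for
  \<open>m \<le> -2\<close>.
\<close>

lemma solution_power_equation:
  assumes "nonneg_solution A R" "1 \<le> a"
  shows "(\<lambda>l. \<Sum>i\<in>UNIV. matrix_pow R l $ k $ i * off_diag (int l - int a) i j)
        sums (matrix_pow R a $ k $ j * exit_rate j)"
proof -
  obtain c where c: "a = Suc c" using assms(2) by (cases a) auto
  let ?f = "\<lambda>l. \<Sum>i\<in>UNIV. matrix_pow R l $ k $ i * off_diag (int l - int a) i j"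
  have "(\<lambda>l. \<Sum>m\<in>UNIV. matrix_pow R c $ k $ m * (\<Sum>i\<in>UNIV. matrix_pow R l $ m $ i * off_diag (int l - 1) i j))
      sums (\<Sum>m\<in>UNIV. matrix_pow R c $ k $ m * (R $ m $ j * exit_rate j))"
    using assms(1) unfolding nonneg_solution_iff by (intro sums_sum sums_mult) blast
  also have "(\<lambda>l. \<Sum>m\<in>UNIV. matrix_pow R c $ k $ m * (\<Sum>i\<in>UNIV. matrix_pow R l $ m $ i * off_diag (int l
        - 1) i j))
      = (\<lambda>l. ?f (l + c))"
  proof (rule ext)
    fix l
    have "(\<Sum>m\<in>UNIV. matrix_pow R c $ k $ m * (\<Sum>i\<in>UNIV. matrix_pow R l $ m $ i * off_diag (int l - 1) i j))
        = (\<Sum>i\<in>UNIV. \<Sum>m\<in>UNIV. matrix_pow R c $ k $ m * matrix_pow R l $ m $ i * off_diag (int l - 1) i j)"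
      by (subst sum.swap) (simp add: sum_distrib_left mult.assoc)
    also have "\<dots> = (\<Sum>i\<in>UNIV. matrix_pow R (c + l) $ k $ i * off_diag (int l - 1) i j)"
      unfolding matrix_pow_add by (simp add: matrix_matrix_mult_def sum_distrib_right)
    also have "\<dots> = ?f (l + c)" using c by (simp add: add.commute)
    finally show "(\<Sum>m\<in>UNIV. matrix_pow R c $ k $ m * (\<Sum>i\<in>UNIV. matrix_pow R l $ m $ i * off_diag (int l
          - 1) i j)) = ?f (l + c)" .
  qed
  also have "(\<Sum>m\<in>UNIV. matrix_pow R c $ k $ m * (R $ m $ j * exit_rate j))
        = matrix_pow R a $ k $ j * exit_rate j"
  proof -
    have "matrix_pow R a = matrix_pow R c ** R"
      using matrix_pow_add[of R c 1] c by (simp add: matrix_pow_Suc)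
    then show ?thesis by (simp add: matrix_matrix_mult_def sum_distrib_right mult.assoc)
  qed
  finally have "(\<lambda>l. ?f (l + c)) sums (matrix_pow R a $ k $ j * exit_rate j)" .
  moreover have "(\<Sum>l<c. ?f l) = 0"
    using c by (intro sum.neutral ballI) (simp add: off_diag_zero)
  ultimately show ?thesis using sums_iff_shift[of ?f c "matrix_pow R a $ k $ j * exit_rate j"] by simp
qed

text \<open>
  Every nonnegative solution dominates the probabilistic one: by induction on \<open>n\<close>, the contribution of paths
  with fewer than \<open>n\<close> steps is bounded for all \<open>a\<close> simultaneously. In particular \<open>descent\<close> is finite.
\<close>

lemma descent_le_solution:
  assumes R: "nonneg_solution A R"
  shows "descent a k j \<le> ennreal (matrix_pow R a $ k $ j * exit_rate j / exit_rate k)"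
proof -
  let ?X = "\<lambda>a k j. matrix_pow R a $ k $ j * exit_rate j / exit_rate k"
  have R0: "0 \<le> matrix_pow R a $ k $ j" for a k j
    using R by (intro matrix_pow_nonneg) (simp add: nonneg_solution_def)
  note pos = less_imp_le[OF exit_rate_pos]
  have X0: "0 \<le> ?X a k j" for a k j using R0 pos by simp
  have base: "descent 0 k j = ennreal (?X 0 k j)" for k j
    using exit_rate_pos[of k] exit_rate_pos[of j] by (simp add: descent_0 mat_def)
  have partial: "(\<Sum>m<n. stay_kernel p (low_set 0) m (Some (0, k)) (Some (- int a, j)))
        \<le> ennreal (?X a k j)" for n a j
  proof (induction n arbitrary: a j)
    case 0
    show ?case by simp
  next
    case (Suc n)
    show ?case
    proof (cases "a = 0")
      case True
      have "(\<Sum>m<Suc n. stay_kernel p (low_set 0) m (Some (0, k)) (Some (- int a, j))) \<le> descent 0 k j"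
        unfolding True descent_def by (rule sum_le_suminf) auto
      then show ?thesis using base True by simp
    next
      case False
      then have a: "1 \<le> a" by simp
      let ?q = "\<lambda>l i. ennreal (off_diag (int l - int a) i j / exit_rate i)"
      have "stay_kernel p (low_set 0) 0 (Some (0, k)) (Some (- int a, j)) = 0" using a by simp
      then have "(\<Sum>m<Suc n. stay_kernel p (low_set 0) m (Some (0, k)) (Some (- int a, j)))
          = (\<Sum>m<n. stay_kernel p (low_set 0) (Suc m) (Some (0, k)) (Some (- int a, j)))"
        unfolding sum.lessThan_Suc_shift by (simp del: stay_kernel.simps)
      also have "\<dots> = (\<Sum>m<n. \<Sum>l. \<Sum>i\<in>UNIV. stay_kernel p (low_set 0) m (Some (0, k)) (Some (- int l, i))
            * ?q l i)"
        unfolding stay_descent_step[OF a] ..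
      also have "\<dots> = (\<Sum>l. \<Sum>i\<in>UNIV. (\<Sum>m<n. stay_kernel p (low_set 0) m (Some (0, k)) (Some (- int l, i)))
            * ?q l i)"
        unfolding suminf_sum_ennreal[symmetric] by (subst sum.swap) (simp add: sum_distrib_right)
      also have "\<dots> \<le> (\<Sum>l. \<Sum>i\<in>UNIV. ennreal (?X l k i) * ?q l i)"
        by (intro suminf_le sum_mono mult_right_mono Suc) auto
      also have "\<dots> = (\<Sum>l. ennreal ((\<Sum>i\<in>UNIV. matrix_pow R l $ k $ i * off_diag (int l
            - int a) i j) / exit_rate k))"
      proof (intro suminf_cong)
        fix l
        have "ennreal (?X l k i) * ?q l i
              = ennreal (matrix_pow R l $ k $ i * off_diag (int l - int a) i j / exit_rate k)" for i
          using X0[of l k i] off_diag_nonneg exit_rate_pos[of i]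
          by (subst ennreal_mult[symmetric]) (auto simp: less_imp_le)
        then show "(\<Sum>i\<in>UNIV. ennreal (?X l k i) * ?q l i)
          = ennreal ((\<Sum>i\<in>UNIV. matrix_pow R l $ k $ i * off_diag (int l - int a) i j) / exit_rate k)"
          using R0 off_diag_nonneg pos by (simp add: sum_divide_distrib)
      qed
      also have "\<dots> = ennreal (?X a k j)"
        using sums_divide[OF solution_power_equation[OF R a], of k j "exit_rate k"] R0 off_diag_nonneg pos
        by (intro suminf_ennreal_eq) (auto intro!: sum_nonneg divide_nonneg_nonneg)
      finally show ?thesis .
    qed
  qed
  show ?thesis unfolding descent_def
    by (rule suminf_le_const) (use partial in auto)
qed

text \<open>
  Conversely \<open>descent 1\<close>, rescaled by the exit rates, solves the equation; by minimality it is \<open>R\<close>.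
\<close>

lemma minimal_solution_power:
  assumes "minimal_nonneg_solution A R"
  shows "descent a k j < \<top>" and "matrix_pow R a $ k $ j
        = enn2real (descent a k j) * exit_rate k / exit_rate j"
proof -
  have sol: "nonneg_solution A R" and min: "\<And>R'. nonneg_solution A R' \<Longrightarrow> R \<le> R'"
    using assms unfolding minimal_nonneg_solution_def by auto
  have fin: "descent a k j < \<top>" for a k j
    using descent_le_solution[OF sol] by (rule le_less_trans) simp
  then show "descent a k j < \<top>" .
  note pos = less_imp_le[OF exit_rate_pos]
  define R' where "R' = (\<chi> k j. enn2real (descent 1 k j) * exit_rate k / exit_rate j)"
  have R'_entry: "R' $ k $ j = enn2real (descent 1 k j) * exit_rate k / exit_rate j" for k j
    by (simp add: R'_def)
  have pow: "matrix_pow R' a $ k $ j = enn2real (descent a k j) * exit_rate k / exit_rate j" for a k j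
  proof (induction a arbitrary: k j)
    case 0
    show ?case using exit_rate_pos[of k] exit_rate_pos[of j] by (simp add: mat_def descent_0)
  next
    case (Suc a)
    have "enn2real (descent (Suc a) k j) = (\<Sum>i\<in>UNIV. enn2real (descent 1 k i) * enn2real (descent a i j))"
      unfolding descent_Suc using fin
      by (subst enn2real_sum) (auto simp: ennreal_mult_less_top enn2real_mult)
    moreover have "matrix_pow R' (Suc a) $ k $ j
          = (\<Sum>i\<in>UNIV. enn2real (descent 1 k i) * enn2real (descent a i j) * exit_rate k / exit_rate j)"
      unfolding matrix_pow_Suc using exit_rate_pos
      by (auto simp: matrix_matrix_mult_def Suc R'_entry less_imp_neq[symmetric] intro!: sum.cong)
    ultimately show ?case by (simp add: sum_distrib_right sum_divide_distrib)
  qed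
  have "nonneg_solution A R'"
    unfolding nonneg_solution_iff
  proof (intro conjI allI)
    show "0 \<le> R'" unfolding less_eq_vec_def R'_def using pos by simp
    fix k j
    let ?f = "\<lambda>l. \<Sum>i\<in>UNIV. enn2real (descent l k i) * off_diag (int l - 1) i j / exit_rate i"
    have f0: "0 \<le> ?f l" for l using off_diag_nonneg pos by (intro sum_nonneg) auto
    have "(\<Sum>i\<in>UNIV. descent l k i * ennreal (off_diag (int l - 1) i j / exit_rate i)) = ennreal (?f l)" for l
    proof -
      have "descent l k i * ennreal (off_diag (int l - 1) i j / exit_rate i)
        = ennreal (enn2real (descent l k i) * off_diag (int l - 1) i j / exit_rate i)" for i
      proof -
        have "descent l k i = ennreal (enn2real (descent l k i))" using fin by simp
        then have "descent l k i * ennreal (off_diag (int l - 1) i j / exit_rate i)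
          = ennreal (enn2real (descent l k i)) * ennreal (off_diag (int l - 1) i j / exit_rate i)" by simp
        also have "\<dots> = ennreal (enn2real (descent l k i) * off_diag (int l - 1) i j / exit_rate i)"
          using off_diag_nonneg pos by (subst ennreal_mult[symmetric]) auto
        finally show ?thesis .
      qed
      then show ?thesis using off_diag_nonneg pos by simp
    qed
    then have eq: "(\<Sum>l. ennreal (?f l)) = ennreal (enn2real (descent 1 k j))"
      using descent_equation[of k j] ennreal_enn2real[OF fin[of 1 k j]] by (simp only:)
    have "(\<Sum>l. ennreal (?f l)) \<noteq> \<top>" unfolding eq by simp
    then have summ: "summable ?f" by (rule summable_suminf_not_top[OF f0])
    have "ennreal (\<Sum>l. ?f l) = ennreal (enn2real (descent 1 k j))"
      using suminf_ennreal2[OF f0 summ] eq by (simp only:)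
    then have "(\<Sum>l. ?f l) = enn2real (descent 1 k j)"
      by (subst (asm) ennreal_inj) (use suminf_nonneg[OF summ f0] in simp_all)
    with summ have "?f sums enn2real (descent 1 k j)" by (simp add: sums_iff)
    from sums_mult2[OF this, of "exit_rate k"]
    have "(\<lambda>l. ?f l * exit_rate k) sums (enn2real (descent 1 k j) * exit_rate k)" .
    also have "(\<lambda>l. ?f l * exit_rate k) = (\<lambda>l. \<Sum>i\<in>UNIV. matrix_pow R' l $ k $ i * off_diag (int l - 1) i j)"
      unfolding pow sum_distrib_right by (intro ext sum.cong) (simp_all add: ac_simps)
    also have "enn2real (descent 1 k j) * exit_rate k = R' $ k $ j * exit_rate j"
      unfolding R'_def using exit_rate_pos[of j] by simp
    finally show "(\<lambda>l. \<Sum>i\<in>UNIV. matrix_pow R' l $ k $ i * off_diag (int l - 1) i j)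
          sums (R' $ k $ j * exit_rate j)" .
  qed
  then have "R \<le> R'" by (rule min)
  moreover have "R' $ k $ j \<le> R $ k $ j" for k j
  proof -
    have R0: "0 \<le> R $ k $ j" using sol by (simp add: nonneg_solution_def less_eq_vec_def)
    have "descent 1 k j \<le> ennreal (R $ k $ j * exit_rate j / exit_rate k)"
      using descent_le_solution[OF sol, of 1 k j] by (simp add: matrix_pow_Suc)
    then have "enn2real (descent 1 k j) \<le> R $ k $ j * exit_rate j / exit_rate k"
      using R0 pos by (intro enn2real_leI) auto
    then show ?thesis unfolding R'_def using exit_rate_pos[of k] exit_rate_pos[of j]
      by (simp add: field_simps)
  qed
  ultimately have "R = R'" by (auto simp: less_eq_vec_def vec_eq_iff intro!: antisym)
  then show "matrix_pow R a $ k $ j = enn2real (descent a k j) * exit_rate k / exit_rate j"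
    using pow by simp
qed

lemma green_less_top: "green b i j < \<top>"
proof -
  have reach: "((0, j), (int b, j)) \<in> {((k, i), (l, j)). 0 < A (l - k) $ i $ j}\<^sup>*"
    using rates unfolding skip_free_map_rates_def by simp
  have edge: "p (Some x) (Some y) \<noteq> 0"
    if e: "(x, y) \<in> {((k, i), (l, j)). 0 < A (l - k) $ i $ j}" for x y
  proof -
    obtain k i l j where xy: "x = (k, i)" "y = (l, j)" "0 < A (l - k) $ i $ j"
      using e by (cases x; cases y) auto
    have "off_diag (l - k) i j = A (l - k) $ i $ j"
      using xy(3) exit_rate_pos[of i] by (auto simp: off_diag_def exit_rate_def)
    then show ?thesis
      using xy exit_rate_pos[of i] by (simp add: kernel_Some ennreal_eq_0_iff not_le)
  qed
  have "(Some (0, j), Some (int b, j)) \<in> {(x, y). p x y \<noteq> 0}\<^sup>*"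
    using reach
  proof (induction rule: rtrancl_induct)
    case (step y z)
    have "(Some y, Some z) \<in> {(x, y). p x y \<noteq> 0}" using edge[OF step(2)] by simp
    with step.IH show ?case by (rule rtrancl_into_rtrancl)
  qed simp
  from green_finite[OF kernel_total this, of "- up_set (int b)" "Some (0, i)"]
  show ?thesis by (simp add: green_def)
qed

text \<open>
  The probability of returning to level \<open>0\<close> in phase \<open>k\<close> before reaching level \<open>b\<close> or above, starting from
  \<open>(0, i)\<close>.
\<close>

definition level_return :: "nat \<Rightarrow> 'n \<Rightarrow> 'n \<Rightarrow> ennreal" where
  "level_return b i k = (\<integral>\<^sup>+ z. p (Some (0, i)) z * (\<Sum>n. taboo_kernel p (- up_set (int b)
        - level_set 0) n z (Some (0, k))) \<partial>count_space UNIV)"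

lemma green_renewal:
  assumes "1 \<le> b"
  shows "green b i j = (if i = j then 1 else 0) + (\<Sum>k\<in>UNIV. level_return b i k * green b k j)"
proof -
  let ?B = "- up_set (int b)" and ?y = "Some (0, j)"
  have first: "(\<Sum>n. taboo_kernel p ?B n z ?y)
        = (\<Sum>k\<in>UNIV. (\<Sum>n. taboo_kernel p (?B - level_set 0) n z (Some (0, k))) * green b k j)" for z
  proof -
    have "(\<Sum>n. taboo_kernel p ?B n z ?y)
        = (\<Sum>n. \<Sum>m\<le>n. \<Sum>f\<in>level_set 0. taboo_kernel p (?B - level_set 0) m z f * taboo_kernel p ?B
              (n - m) f ?y)"
      by (intro suminf_cong taboo_first_entrance) auto
    also have "\<dots> = (\<Sum>f\<in>level_set 0. \<Sum>n. \<Sum>m\<le>n. taboo_kernel p (?B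
          - level_set 0) m z f * taboo_kernel p ?B (n - m) f ?y)"
      by (subst sum.swap) (rule suminf_sum_ennreal)
    also have "\<dots> = (\<Sum>f\<in>level_set 0. (\<Sum>n. taboo_kernel p (?B
          - level_set 0) n z f) * (\<Sum>n. taboo_kernel p ?B n f ?y))"
      by (intro sum.cong refl suminf_convolution_ennreal)
    finally show ?thesis unfolding sum_level_set green_def .
  qed
  have "green b i j = (\<Sum>n. taboo_kernel p ?B (Suc n) (Some (0, i)) ?y) + taboo_kernel p ?B 0 (Some (0, i)) ?y"
    unfolding green_def by (subst suminf_offset[of _ 1]) (simp_all del: taboo_kernel.simps)
  also have "(\<Sum>n. taboo_kernel p ?B (Suc n) (Some (0, i)) ?y)
      = (\<Sum>n. \<integral>\<^sup>+ z. p (Some (0, i)) z * taboo_kernel p ?B n z ?y \<partial>count_space UNIV)"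
    using assms by simp
  also have "\<dots> = (\<integral>\<^sup>+ z. p (Some (0, i)) z * (\<Sum>n. taboo_kernel p ?B n z ?y) \<partial>count_space UNIV)"
    by (subst nn_integral_suminf[symmetric]) simp_all
  also have "\<dots> = (\<Sum>k\<in>UNIV. level_return b i k * green b k j)"
    unfolding first level_return_def
    by (simp add: sum_distrib_left nn_integral_sum nn_integral_multc flip: mult.assoc)
  finally show ?thesis by (auto simp: indicator_def add.commute)
qed

text \<open>
  The negative of the generator of the process watched on level \<open>0\<close> and killed at the passage to level \<open>b\<close>:
  for \<open>b \<ge> 1\<close>, the inverse of the matrix of expected local times.
\<close>

definition exit_matrix :: "nat \<Rightarrow> real^'n^'n" where
  "exit_matrix b = (\<chi> i j. exit_rate i * ((if i = j then 1 else 0) - enn2real (level_return b i j)))"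

lemma hit_time_eq: "hit_time Z x \<omega> = right_cont_process.entry_time Z (level_set x) \<omega>"
proof -
  interpret bounded_markov_chain "P undefined" gen "Some (0, undefined)" Z "\<Sum>i\<in>UNIV. exit_rate i"
    by (rule process)
  have "level Z t \<omega> = Some x \<longleftrightarrow> Z t \<omega> \<in> level_set x" for t
    unfolding level_def level_set_def by (cases "Z t \<omega>") auto
  then show ?thesis unfolding hit_time_def entry_time_def by simp
qed

lemma up_time_eq: "up_time Z x \<omega> = right_cont_process.entry_time Z (up_set x) \<omega>"
proof -
  interpret bounded_markov_chain "P undefined" gen "Some (0, undefined)" Z "\<Sum>i\<in>UNIV. exit_rate i"
    by (rule process)
  have "(\<exists>k\<ge>x. level Z t \<omega> = Some k) \<longleftrightarrow> Z t \<omega> \<in> up_set x" for t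
    unfolding level_def up_set_def by (cases "Z t \<omega>") auto
  then show ?thesis unfolding up_time_def entry_time_def by simp
qed

lemma expected_local_time_eq:
  assumes "1 \<le> m"
  shows "expected_local_time P Z m i j = green m i j * ennreal (1 / exit_rate j)"
proof -
  interpret bounded_markov_chain "P i" gen "Some (0, i)" Z "\<Sum>i\<in>UNIV. exit_rate i"
    by (rule process)
  show ?thesis
    unfolding expected_local_time_def local_time_def up_time_eq green_def
    using expected_occupation_time[of "Some (0, j)" "up_set (int m)"] exit_rate_pos[of j] assms
    by (simp add: exit_rate_def)
qed

lemma Xi_entry:
  assumes "1 \<le> m"
  shows "Xi P Z m $ i $ j = enn2real (green m i j) / exit_rate j"
  using exit_rate_pos[of j]
  by (simp add: Xi_def expected_local_time_eq[OF assms] enn2real_mult)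

lemma Xi_invertible:
  assumes "1 \<le> b"
  shows "invertible (Xi P Z b)"
proof -
  \<comment> \<open>The diagonal of \<open>green\<close> is at least one, so \<open>level_return\<close> is dominated by \<open>green\<close>.\<close>
  have ret: "level_return b i k < \<top>" for i k
  proof -
    have "1 \<le> green b k k" unfolding green_renewal[OF assms, of k k] by simp
    then have "level_return b i k * 1 \<le> level_return b i k * green b k k" by (rule mult_left_mono) simp
    also have "\<dots> \<le> (\<Sum>l\<in>UNIV. level_return b i l * green b l k)" by (rule member_le_sum) auto
    also have "\<dots> \<le> green b i k" unfolding green_renewal[OF assms, of i k] by simp
    finally show ?thesis using green_less_top[of b i k] by simp
  qed
  have real: "enn2real (green b i j) = (if i = j then 1 else 0)
      + (\<Sum>k\<in>UNIV. enn2real (level_return b i k) * enn2real (green b k j))" for i j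
  proof -
    have "enn2real (\<Sum>k\<in>UNIV. level_return b i k * green b k j)
      = (\<Sum>k\<in>UNIV. enn2real (level_return b i k) * enn2real (green b k j))"
      using ret green_less_top by (subst enn2real_sum) (auto simp: ennreal_mult_less_top enn2real_mult)
    moreover have "(\<Sum>k\<in>UNIV. level_return b i k * green b k j) < \<top>"
      using ret green_less_top by (auto simp: ennreal_mult_less_top)
    ultimately show ?thesis
      by (subst green_renewal[OF assms]) (auto simp: enn2real_plus)
  qed
  have "exit_matrix b ** Xi P Z b = mat 1"
  proof (unfold vec_eq_iff, intro allI)
    fix i j
    have "(exit_matrix b ** Xi P Z b) $ i $ j
      = (\<Sum>k\<in>UNIV. (exit_rate i * (if i = k then enn2real (green b k j) else 0) 
           - exit_rate i * (enn2real (level_return b i k) * enn2real (green b k j))) / exit_rate j)"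
      unfolding matrix_matrix_mult_def
      by (auto intro!: sum.cong simp: exit_matrix_def Xi_entry[OF assms] algebra_simps diff_divide_distrib)
    also have "\<dots> = exit_rate i * (enn2real (green b i j)
           - (\<Sum>k\<in>UNIV. enn2real (level_return b i k) * enn2real (green b k j))) / exit_rate j"
      by (simp add: sum_divide_distrib[symmetric] sum_subtractf sum_distrib_left[symmetric] right_diff_distrib)
    also have "\<dots> = (mat 1 :: real^'n^'n) $ i $ j"
      unfolding real[of i j] using exit_rate_pos[of i] exit_rate_pos[of j] by (simp add: mat_def)
    finally show "(exit_matrix b ** Xi P Z b) $ i $ j = (mat 1 :: real^'n^'n) $ i $ j" .
  qed
  then show ?thesis unfolding invertible_left_inverse by blast
qed

lemma D_entry:
  assumes "1 \<le> b"
  shows "D P Z a b $ i $ j = enn2real (passage a b i j)" and "passage a b i j < \<top>"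
proof -
  interpret bounded_markov_chain "P i" gen "Some (0, i)" Z "\<Sum>i\<in>UNIV. exit_rate i"
    by (rule process)
  have disj: "level_set (- int a) \<inter> up_set (int b) = ({} :: (int \<times> 'n) option set)"
    using assms by (auto simp: level_set_def up_set_def)
  let ?h = "\<lambda>\<omega>. entry_time (level_set (- int a)) \<omega>" and ?u = "\<lambda>\<omega>. entry_time (up_set (int b)) \<omega>"
  have E: "emeasure (P i) {\<omega> \<in> space (P i). ?h \<omega> < ?u \<omega> \<and> Z (real_of_ereal (?h \<omega>)) \<omega>
        = Some (- int a, j)} = passage a b i j"
    unfolding passage_def by (rule first_hit_prob[OF disj]) simp
  show "passage a b i j < \<top>"
    unfolding E[symmetric] emeasure_eq_measure by (rule ennreal_less_top)
  have lv: "Z (real_of_ereal (?h \<omega>)) \<omega> \<in> level_set (- int a)" if "\<omega> \<in> space (P i)" "?h \<omega> < ?u \<omega>" for \<omega>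
    by (rule entry_time_attained) (use that in auto)
  have "{\<omega> \<in> space (P i). hit_time Z (- int a) \<omega> < up_time Z (int b) \<omega> \<and>
              phase Z (real_of_ereal (hit_time Z (- int a) \<omega>)) \<omega> = Some j}
      = {\<omega> \<in> space (P i). ?h \<omega> < ?u \<omega> \<and> Z (real_of_ereal (?h \<omega>)) \<omega> = Some (- int a, j)}"
    unfolding hit_time_eq up_time_eq phase_def using lv by (fastforce simp: level_set_def)
  then show "D P Z a b $ i $ j = enn2real (passage a b i j)"
    using assms E by (simp add: D_def measure_def)
qed

lemma expected_local_time_finite:
  assumes "1 \<le> m"
  shows "expected_local_time P Z m i j < \<infinity>"
  unfolding expected_local_time_eq[OF assms] using green_less_top[of m i j]
  by (simp add: ennreal_mult_less_top)

text \<open>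
  Both sides are, up to the exit rate of \<open>j\<close>, the expected number of visits to \<open>(- a, j)\<close> before the passage
  to level \<open>b\<close>.
\<close>

lemma D_mult_Xi:
  assumes R: "minimal_nonneg_solution A R" and b: "1 \<le> b"
  shows "D P Z a b ** Xi P Z (a + b) = Xi P Z b ** matrix_pow R a"
proof (unfold vec_eq_iff, intro allI)
  fix i j
  note fin = minimal_solution_power(1)[OF R] D_entry(2)[OF b] green_less_top
  have ab: "1 \<le> a + b" using b by simp
  have "(D P Z a b ** Xi P Z (a + b)) $ i $ j
      = (\<Sum>k\<in>UNIV. enn2real (passage a b i k) * enn2real (green (a + b) k j)) / exit_rate j"
    by (simp add: matrix_matrix_mult_def D_entry(1)[OF b] Xi_entry[OF ab] sum_divide_distrib)
  also have "(\<Sum>k\<in>UNIV. enn2real (passage a b i k) * enn2real (green (a + b) k j))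
      = enn2real (\<Sum>k\<in>UNIV. passage a b i k * green (a + b) k j)"
    using fin by (subst enn2real_sum) (auto simp: ennreal_mult_less_top enn2real_mult)
  also have "(\<Sum>k\<in>UNIV. passage a b i k * green (a + b) k j) = (\<Sum>k\<in>UNIV. green b i k * descent a k j)"
    using green_first_passage[of b i a j] green_last_exit[OF b, of i a j] by simp
  also have "enn2real (\<Sum>k\<in>UNIV. green b i k * descent a k j)
      = (\<Sum>k\<in>UNIV. enn2real (green b i k) * enn2real (descent a k j))"
    using fin by (subst enn2real_sum) (auto simp: ennreal_mult_less_top enn2real_mult)
  also have "\<dots> / exit_rate j = (Xi P Z b ** matrix_pow R a) $ i $ j"
    unfolding matrix_matrix_mult_def sum_divide_distrib using exit_rate_pos
    by (auto intro!: sum.cong simp: Xi_entry[OF b] minimal_solution_power(2)[OF R] less_imp_neq[symmetric])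
  finally show "(D P Z a b ** Xi P Z (a + b)) $ i $ j = (Xi P Z b ** matrix_pow R a) $ i $ j" .
qed

lemma D_zero:
  assumes "1 \<le> a"
  shows "D P Z a 0 = 0"
proof (unfold vec_eq_iff, intro allI)
  fix i j
  interpret bounded_markov_chain "P i" gen "Some (0, i)" Z "\<Sum>i\<in>UNIV. exit_rate i"
    by (rule process)
  let ?E = "{\<omega> \<in> space (P i). hit_time Z (- int a) \<omega> < up_time Z (int 0) \<omega> \<and>
              phase Z (real_of_ereal (hit_time Z (- int a) \<omega>)) \<omega> = Some j}"
  have "AE \<omega> in P i. \<omega> \<notin> ?E"
    using AE_start
  proof eventually_elim
    case (elim \<omega>)
    have "0 \<le> hit_time Z (- int a) \<omega>" unfolding hit_time_def by (rule Inf_greatest) auto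
    moreover have "up_time Z (int 0) \<omega> \<le> 0"
      unfolding up_time_def using elim by (intro Inf_lower) (auto simp: level_def zero_ereal_def)
    ultimately have "up_time Z (int 0) \<omega> \<le> hit_time Z (- int a) \<omega>" by (rule order_trans[rotated])
    then show ?case by (auto simp: not_less)
  qed
  then have "measure (P i) ?E = 0"
  \<comment> \<open>A non-measurable set has \<open>measure\<close> zero by convention, so measurability need not be checked.\<close>
  proof (cases "?E \<in> events")
    case True
    with \<open>AE \<omega> in P i. \<omega> \<notin> ?E\<close> show ?thesis using prob_eq_0 by blast
  next
    case False
    then show ?thesis by (rule measure_notin_sets)
  qed
  then show "D P Z a 0 $ i $ j = 0 $ i $ j" using assms by (simp add: D_def)
qed

end

theorem lemma6p1:
  fixes A :: "int \<Rightarrow> real^'n^'n"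
    and R :: "real^'n^'n"
    and P :: "'n \<Rightarrow> 'w measure"
    and Z :: "real \<Rightarrow> 'w \<Rightarrow> (int \<times> 'n) option"
  assumes "skip_free_map_rates A"
    and "minimal_nonneg_solution A R"
    and "\<And>i. markov_chain (P i) (map_generator A) (Some (0, i)) Z"
  shows "(\<forall>m\<ge>1. (\<forall>i j. expected_local_time P Z m i j < \<infinity>) \<and> invertible (Xi P Z m)) \<and>
    (\<forall>a b. 1 \<le> b \<longrightarrow>
       D P Z a b = Xi P Z b ** matrix_pow R a ** matrix_inv (Xi P Z (a + b))) \<and>
    (\<forall>a\<ge>1. D P Z a 0 = 0) \<and> D P Z 0 0 = mat 1"
proof -
  interpret skip_free_map A P Z
    by (rule skip_free_map.intro) (rule assms)+
  have "D P Z a b = Xi P Z b ** matrix_pow R a ** matrix_inv (Xi P Z (a + b))" if b: "1 \<le> b" for a b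
  proof -
    have "invertible (Xi P Z (a + b))" using b by (intro Xi_invertible) simp
    then have inv: "Xi P Z (a + b) ** matrix_inv (Xi P Z (a + b)) = mat 1"
      unfolding invertible_def matrix_inv_def by (rule someI_ex[THEN conjunct1])
    have "D P Z a b = D P Z a b ** (Xi P Z (a + b) ** matrix_inv (Xi P Z (a + b)))"
      unfolding inv by simp
    then show ?thesis unfolding matrix_mul_assoc D_mult_Xi[OF assms(2) b] .
  qed
  moreover have "D P Z 0 0 = mat 1" by (simp add: D_def)
  ultimately show ?thesis
    using expected_local_time_finite Xi_invertible D_zero by blast
qed

end
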